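(* Let $\mathscr{X}=(\mathcal{X},d,\mu)$ be a compact homogeneous space, $p\geq 1$, and $\varphi\in\mathscr{C}_b(\mathbb{R}^{\binom p2})$ such that $A=\|\varphi\|_\infty$ and $\sigma^2_{\mathrm{hom}}(\varphi,\mathscr{X})>0$. Set $\sigma^2_{n,\mathrm{hom}}=\mathrm{var}(S_n(\varphi,\mathscr{X}))/n^{2(p-1)}$ and $q_n=\frac{2Ap^2}{\sigma_{n,\mathrm{hom}}}$. Then $q_n\geq1$, and for any $x\geq0$ and any $n$, $$\mathbb{P}\!\left[|Y_n(\varphi,\mathscr{X})|\geq\frac{q_nx}{e}\right]\leq 2\exp\!\left(\frac{\log(1+x)-x}{e^2}\right).$$ The same estimate holds with $Y_n(\varphi,\mathscr{X})$ replaced by its limit in distribution $Y(\varphi,\mathscr{X})$ and $q_n$ replaced by its limit $q=\frac{2Ap^2}{\sigma_{\mathrm{hom}}}$.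
   Context: A metric measure space (mm-space) $\mathscr{X}=(\mathcal{X},d,\mu)$ is a complete separable metric space with a Borel probability measure $\mu$, with $\mathcal{X}=\mathrm{supp}(\mu)$. It is a compact homogeneous space if, up to a measure-preserving isometry, it equals $(G/K,d_{G/K},\mu_{G/K})$ with $G$ a compact topological group, $K$ a closed subgroup, $d_{G/K}$ a $G$-invariant distance and $\mu_{G/K}$ the push-forward of the Haar probability measure of $G$; equivalently, the group of measure-preserving isometries of $\mathcal{X}$ acts transitively on $\mathcal{X}$. Let $(X_i)_{i\geq1}$ be i.i.d. with law $\mu$, $S_n(\varphi,\mathscr{X})=\sum_{(i_1,\dots,i_p)\in\{1,\dots,n\}^p}\varphi\big((d(X_{i_a},X_{i_b}))_{1\leq a<b\leq p}\big)$ and $\Phi(\mathscr{X}_n)=n^{-p}S_n(\varphi,\mathscr{X})$. For $\mathscr{X}$ compact homogeneous, the limit $\sigma^2_{\mathrm{hom}}(\varphi,\mathscr{X})=\lim_{n\to\infty}\mathrm{var}(S_n(\varphi,\mathscr{X}))/n^{2(p-1)}$ exists, and when it is positive, the variables $$Y_n(\varphi,\mathscr{X})=\frac{\Phi(\mathscr{X}_n)-\mathbb{E}[\Phi(\mathscr{X}_n)]}{\sqrt{\mathrm{var}(\Phi(\mathscr{X}_n))}}$$ (defined for those $n$ with $\mathrm{var}(\Phi(\mathscr{X}_n))>0$) converge in distribution, with convergence of all cumulants, to a random variable $Y(\varphi,\mathscr{X})$ determined by its moments. Here $e=\exp(1)$. *)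

theory Defs
  imports "HOL-Probability.Probability" "HOL-Algebra.Left_Coset"
begin

text \<open>A metric measure space is a type of class \<open>polish_space\<close> (a complete separable metric space,
  with its fixed distance \<open>dist\<close>) together with a fully supported Borel probability measure.\<close>

definition measure_support :: "'a::topological_space measure \<Rightarrow> 'a set" where
  "measure_support \<mu> = {x. \<forall>U. open U \<and> x \<in> U \<longrightarrow> emeasure \<mu> U > 0}"

definition mm_space :: "'a::polish_space measure \<Rightarrow> bool" where
  "mm_space \<mu> \<longleftrightarrow> prob_space \<mu> \<and> sets \<mu> = sets borel \<and> measure_support \<mu> = UNIV"

definition compact_group :: "('g, 'z) monoid_scheme \<Rightarrow> 'g topology \<Rightarrow> bool" where
  "compact_group G T \<longleftrightarrow> group G \<and> topspace T = carrier G \<and>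
     continuous_map (prod_topology T T) T (\<lambda>(x, y). x \<otimes>\<^bsub>G\<^esub> y) \<and>
     continuous_map T T (\<lambda>x. inv\<^bsub>G\<^esub> x) \<and>
     compact_space T \<and> Hausdorff_space T"

definition borel_of_topology :: "'b topology \<Rightarrow> 'b measure" where
  "borel_of_topology T = sigma (topspace T) {U. openin T U}"

text \<open>On a compact group there is exactly one measure with this property. Compact groups need not
  be metrizable, so regularity has to be required explicitly.\<close>

definition haar_probability :: "('g, 'z) monoid_scheme \<Rightarrow> 'g topology \<Rightarrow> 'g measure \<Rightarrow> bool" where
  "haar_probability G T h \<longleftrightarrow> prob_space h \<and> space h = topspace T \<and>
     sets h = sets (borel_of_topology T) \<and>
     (\<forall>g\<in>carrier G. distr h h (\<lambda>x. g \<otimes>\<^bsub>G\<^esub> x) = h) \<and>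
     (\<forall>B\<in>sets h. emeasure h B = (SUP C\<in>{C. compactin T C \<and> C \<subseteq> B}. emeasure h C))"

text \<open>A distance on \<open>G/K\<close>, realised as the set of left cosets, is understood to induce the quotient
  topology.\<close>

definition invariant_quotient_distance ::
  "('g, 'z) monoid_scheme \<Rightarrow> 'g topology \<Rightarrow> 'g set \<Rightarrow> ('g set \<Rightarrow> 'g set \<Rightarrow> real) \<Rightarrow> bool" where
  "invariant_quotient_distance G T K D \<longleftrightarrow>
     Metric_space (lcosets\<^bsub>G\<^esub> K) D \<and>
     quotient_map T (Metric_space.mtopology (lcosets\<^bsub>G\<^esub> K) D) (\<lambda>g. g <#\<^bsub>G\<^esub> K) \<and>
     (\<forall>g\<in>carrier G. \<forall>P\<in>lcosets\<^bsub>G\<^esub> K. \<forall>Q\<in>lcosets\<^bsub>G\<^esub> K.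
        D (g <#\<^bsub>G\<^esub> P) (g <#\<^bsub>G\<^esub> Q) = D P Q)"

definition quotient_haar ::
  "('g, 'z) monoid_scheme \<Rightarrow> 'g set \<Rightarrow> ('g set \<Rightarrow> 'g set \<Rightarrow> real) \<Rightarrow> 'g measure \<Rightarrow> 'g set measure" where
  "quotient_haar G K D h =
     distr h (borel_of_topology (Metric_space.mtopology (lcosets\<^bsub>G\<^esub> K) D)) (\<lambda>g. g <#\<^bsub>G\<^esub> K)"

text \<open>The group is a parameter because one cannot quantify existentially over its type; in a
  theorem that assumes this predicate, \<open>G\<close> and \<open>T\<close> (and the type of \<open>G\<close>) are arbitrary.\<close>

definition compact_homogeneous_space ::
  "('g, 'z) monoid_scheme \<Rightarrow> 'g topology \<Rightarrow> 'a::polish_space measure \<Rightarrow> bool" where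
  "compact_homogeneous_space G T \<mu> \<longleftrightarrow> mm_space \<mu> \<and> compact_group G T \<and>
     (\<exists>K D h f. subgroup K G \<and> closedin T K \<and>
        invariant_quotient_distance G T K D \<and> haar_probability G T h \<and>
        bij_betw f (UNIV :: 'a set) (lcosets\<^bsub>G\<^esub> K) \<and>
        (\<forall>x y. D (f x) (f y) = dist x y) \<and>
        distr \<mu> (borel_of_topology (Metric_space.mtopology (lcosets\<^bsub>G\<^esub> K) D)) f
          = quotient_haar G K D h)"

definition iid_sequence :: "'w measure \<Rightarrow> (nat \<Rightarrow> 'w \<Rightarrow> 'a::topological_space) \<Rightarrow> 'a measure \<Rightarrow> bool" where
  "iid_sequence M X \<mu> \<longleftrightarrow> prob_space M \<and>
     prob_space.indep_vars M (\<lambda>_. borel) X {1..} \<and> (\<forall>i\<ge>1. distr M borel (X i) = \<mu>)"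

text \<open>\<open>\<real>\<^sup>N\<close> with \<open>N = p choose 2\<close> is the product space \<open>powertop_real (index_pairs p)\<close>, whose points
  are the extensional functions on \<open>index_pairs p\<close>; for \<open>p = 1\<close> it is a single point.\<close>

definition index_pairs :: "nat \<Rightarrow> (nat \<times> nat) set" where
  "index_pairs p = {(a, b). 1 \<le> a \<and> a < b \<and> b \<le> p}"

definition bounded_continuous :: "nat \<Rightarrow> ((nat \<times> nat \<Rightarrow> real) \<Rightarrow> real) \<Rightarrow> bool" where
  "bounded_continuous p \<phi> \<longleftrightarrow> continuous_map (powertop_real (index_pairs p)) euclideanreal \<phi> \<and>
     bounded (\<phi> ` topspace (powertop_real (index_pairs p)))"

definition sup_norm :: "nat \<Rightarrow> ((nat \<times> nat \<Rightarrow> real) \<Rightarrow> real) \<Rightarrow> real" where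
  "sup_norm p \<phi> = (SUP v\<in>topspace (powertop_real (index_pairs p)). \<bar>\<phi> v\<bar>)"

definition S_stat :: "nat \<Rightarrow> ((nat \<times> nat \<Rightarrow> real) \<Rightarrow> real) \<Rightarrow> (nat \<Rightarrow> 'w \<Rightarrow> 'a::metric_space)
    \<Rightarrow> nat \<Rightarrow> 'w \<Rightarrow> real" where
  "S_stat p \<phi> X n \<omega> = (\<Sum>i\<in>{1..p} \<rightarrow>\<^sub>E {1..n}.
      \<phi> (\<lambda>(a, b)\<in>index_pairs p. dist (X (i a) \<omega>) (X (i b) \<omega>)))"

definition Phi_stat :: "nat \<Rightarrow> ((nat \<times> nat \<Rightarrow> real) \<Rightarrow> real) \<Rightarrow> (nat \<Rightarrow> 'w \<Rightarrow> 'a::metric_space)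
    \<Rightarrow> nat \<Rightarrow> 'w \<Rightarrow> real" where
  "Phi_stat p \<phi> X n \<omega> = S_stat p \<phi> X n \<omega> / real n ^ p"

definition sigma2_n_hom :: "'w measure \<Rightarrow> nat \<Rightarrow> ((nat \<times> nat \<Rightarrow> real) \<Rightarrow> real)
    \<Rightarrow> (nat \<Rightarrow> 'w \<Rightarrow> 'a::metric_space) \<Rightarrow> nat \<Rightarrow> real" where
  "sigma2_n_hom M p \<phi> X n = prob_space.variance M (S_stat p \<phi> X n) / real n ^ (2 * (p - 1))"

definition sigma2_hom :: "'w measure \<Rightarrow> nat \<Rightarrow> ((nat \<times> nat \<Rightarrow> real) \<Rightarrow> real)
    \<Rightarrow> (nat \<Rightarrow> 'w \<Rightarrow> 'a::metric_space) \<Rightarrow> real" where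
  "sigma2_hom M p \<phi> X = lim (sigma2_n_hom M p \<phi> X)"

text \<open>Meaningful only if the variance of \<open>Phi_stat\<close> is positive; otherwise the quotient is \<open>0\<close>.\<close>

definition Y_stat :: "'w measure \<Rightarrow> nat \<Rightarrow> ((nat \<times> nat \<Rightarrow> real) \<Rightarrow> real)
    \<Rightarrow> (nat \<Rightarrow> 'w \<Rightarrow> 'a::metric_space) \<Rightarrow> nat \<Rightarrow> 'w \<Rightarrow> real" where
  "Y_stat M p \<phi> X n \<omega> =
     (Phi_stat p \<phi> X n \<omega> - prob_space.expectation M (Phi_stat p \<phi> X n))
       / sqrt (prob_space.variance M (Phi_stat p \<phi> X n))"

end

theory Submission
  imports Defs
begin

text \<open>Put \<open>F = S\<^sub>n / (2 A p\<^sup>2 n\<^bsup>p-1\<^esup>)\<close>. Changing one coordinate moves \<open>F\<close> by at most \<open>1/p\<close>, its mixed second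
  differences are at most \<open>2/n\<close>, and by homogeneity conditioning on a single coordinate does not change the
  mean. Let \<open>d\<^sub>k\<close> be the increments of the Doob martingale of \<open>F\<close>. For a fixed value of the \<open>k\<close>-th coordinate,
  \<open>d\<^sub>k\<close> is a centred function of the earlier coordinates with oscillations \<open>2/n\<close>, so by Hoeffding's lemma it is
  subgaussian with variance proxy \<open>1/n\<close>; in particular \<open>Var F \<le> 1\<close>, which is \<open>q\<^sub>n \<ge> 1\<close>. Jensen's inequality then
  bounds an exponential moment of the predictable quadratic variation \<open>V\<close>. Combined with the supermartingale
  \<open>exp (2\<lambda> (F - E F) - c V)\<close> and the Cauchy-Schwarz inequality, this gives \<open>E exp (\<lambda> (F - E F)) \<le> 1.31\<close> for
  \<open>\<bar>\<lambda>\<bar> = 1/e\<close>. Markov's inequality yields the tail bound for \<open>x \<ge> 7\<close>; for \<open>x \<le> 7\<close> its right-hand side is at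
  least \<open>1\<close>.

  The normalised variance converges because \<open>Var S\<^sub>n\<close> is a combination of the binomial coefficients \<open>n choose k\<close>
  with \<open>k \<le> 2 (p - 1)\<close>: the covariance of two kernels sharing at most one index vanishes.\<close>

section \<open>Moment generating functions\<close>

text \<open>The obstacle: uniformly the increments are only bounded by 1/2, and Azuma's inequality
  would then allow fluctuations of order sqrt n. They have size 1/sqrt n only in the sense of
  exponential moments. Hence V is of order 1 but need not be bounded, and E exp (a V) is controlled
  only for 2 a < 1. This gives the exponential tail of a second-order chaos instead of a Gaussian
  one, and it limits \<lambda>; for \<lambda> = 1/e the supermartingale requires a = (3/5) (2/e)^2 <
  0.33, which is admissible.

  In Markov's inequality the deviation x/e is multiplied by \<lambda> = 1/e, whence the e^2 in the
  exponent. The factor exp (log (1+x) / e^2) of the target is slack: at x = 7 it already exceeds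
  1.31, while x - log (1+x) stays below e^2 log 2 up to x = 7.

  Conditional expectations are taken as integrals over single coordinates of an infinite product, so
  that all identities hold at every point and no null sets occur.\<close>

lemma (in prob_space) mgf_le_of_oscillation:
  fixes g :: "'a \<Rightarrow> real"
  assumes [measurable]: "g \<in> borel_measurable M"
    and osc: "\<And>x y. \<bar>g x - g y\<bar> \<le> c"
  shows "expectation (\<lambda>x. exp (s * (g x - expectation g))) \<le> exp (s\<^sup>2 * c\<^sup>2 / 8)"
proof -
  have c0: "0 \<le> c" using osc[of undefined undefined] by simp
  \<comment> \<open>Hoeffding's lemma is applied on the interval from the infimum to the supremum of
    \<open>g\<close>, whose length is at most \<open>c\<close>. A negative \<open>s\<close> is
    reduced to this case by passing to \<open>- g\<close>.\<close>
  have pos: "expectation (\<lambda>x. exp (s * (g x - expectation g))) \<le> exp (s\<^sup>2 * c\<^sup>2 / 8)"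
    if [measurable]: "g \<in> borel_measurable M" and osc: "\<And>x y. \<bar>g x - g y\<bar> \<le> c" and s: "s > 0"
    for g :: "'a \<Rightarrow> real" and s
  proof -
    define a b where "a = (INF x. g x)" and "b = (SUP x. g x)"
    have bd: "g x \<le> g y + c" "g y - c \<le> g x" for x y using osc[of x y] by auto
    have "bdd_below (range g)" "bdd_above (range g)"
      using bd[of _ undefined] bd[of undefined]
    by (auto intro!: bdd_belowI[of _ "g undefined - c"] bdd_aboveI[of _ "g undefined + c"] simp: algebra_simps)
    then have ab: "a \<le> g x" "g x \<le> b" for x
      unfolding a_def b_def by (auto intro: cINF_lower cSUP_upper)
    have "g x - c \<le> a" for x unfolding a_def by (rule cINF_greatest) (use bd(2)[of x] in auto)
    then have "g x \<le> a + c" for x by (simp add: algebra_simps)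
    then have "b \<le> a + c" unfolding b_def by (intro cSUP_least) auto
    moreover have "a \<le> b" using ab[of undefined] by simp
    ultimately have "(b - a)\<^sup>2 \<le> c\<^sup>2" by (intro power_mono) auto
    interpret g: interval_bounded_random_variable M g a b
      by unfold_locales (use ab in auto)
    have "nn_integral M (\<lambda>x. exp (s * (g x - expectation g))) \<le> ennreal (exp (s\<^sup>2 * (b - a)\<^sup>2 / 8))"
      using g.Hoeffdings_lemma_nn_integral[OF s] .
    also have "\<dots> \<le> ennreal (exp (s\<^sup>2 * c\<^sup>2 / 8))"
      using \<open>(b - a)\<^sup>2 \<le> c\<^sup>2\<close> by (intro ennreal_leI) (auto intro!: mult_left_mono)
    finally show ?thesis
      by (intro integral_real_bounded) auto
  qed
  consider "s > 0" | "s = 0" | "s < 0" by linarith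
  then show ?thesis
  proof cases
    case 3
    have eq: "- s * (- g x - expectation (\<lambda>x. - g x)) = s * (g x - expectation g)" for x
      by (simp add: algebra_simps)
    have "expectation (\<lambda>x. exp (- s * (- g x - expectation (\<lambda>x. - g x)))) \<le> exp ((- s)\<^sup>2 * c\<^sup>2 / 8)"
      by (rule pos) (use 3 osc in \<open>auto simp: abs_minus_commute\<close>)
    then show ?thesis unfolding eq by simp
  qed (use pos osc assms(1) prob_space in auto)
qed

lemma (in prob_space) abs_expectation_le:
  fixes f :: "'a \<Rightarrow> real"
  assumes "integrable M f" "\<And>x. \<bar>f x\<bar> \<le> c" shows "\<bar>expectation f\<bar> \<le> c"
  using assms by (intro abs_leI) (auto intro!: integral_le_const integral_ge_const simp: abs_le_iff
    simp flip: Bochner_Integration.integral_minus)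

text \<open>Completing the square: the exponential tilt moves the mean of the Gaussian to
  \<open>b\<close>.\<close>

lemma std_normal_density_mgf:
  "(\<integral>\<^sup>+g. ennreal (std_normal_density g * exp (b * g)) \<partial>lborel) = ennreal (exp (b\<^sup>2 / 2))"
proof -
  have "std_normal_density g * exp (b * g) = exp (b\<^sup>2 / 2) * normal_density b 1 g" for g
    by (simp add: normal_density_def mult_exp_exp power2_eq_square field_simps)
  then have "(\<integral>\<^sup>+g. ennreal (std_normal_density g * exp (b * g)) \<partial>lborel)
      = ennreal (exp (b\<^sup>2 / 2)) * (\<integral>\<^sup>+g. ennreal (normal_density b 1 g) \<partial>lborel)"
    by (simp add: nn_integral_cmult ennreal_mult)
  also have "(\<integral>\<^sup>+g. ennreal (normal_density b 1 g) \<partial>lborel) = 1"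
    by (subst nn_integral_eq_integral) auto
  finally show ?thesis by simp
qed

text \<open>The tilted density is a multiple of the centred Gaussian density with variance 1/(1 -
  t).\<close>

lemma std_normal_density_exp_square:
  assumes "t < (1 :: real)"
  shows "(\<integral>\<^sup>+g. ennreal (std_normal_density g * exp (t * g\<^sup>2 / 2)) \<partial>lborel) = ennreal (1 / sqrt (1 - t))"
proof -
  define s where "s = 1 / sqrt (1 - t)"
  have s: "s > 0" using assms by (simp add: s_def)
  have s2: "1 / s\<^sup>2 = 1 - t" using assms by (simp add: s_def power_divide)
  have "std_normal_density g * exp (t * g\<^sup>2 / 2) = s * normal_density 0 s g" for g
  proof -
    have "- g\<^sup>2 / (2 * s\<^sup>2) = - g\<^sup>2 / 2 * (1 / s\<^sup>2)" by simp
    also have "\<dots> = - g\<^sup>2 / 2 + t * g\<^sup>2 / 2" unfolding s2 by (simp add: field_simps)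
    finally show ?thesis
      using s by (simp add: normal_density_def mult_exp_exp real_sqrt_mult)
  qed
  then have "(\<integral>\<^sup>+g. ennreal (std_normal_density g * exp (t * g\<^sup>2 / 2)) \<partial>lborel)
      = ennreal s * (\<integral>\<^sup>+g. ennreal (normal_density 0 s g) \<partial>lborel)"
    using s by (simp add: nn_integral_cmult ennreal_mult)
  also have "(\<integral>\<^sup>+g. ennreal (normal_density 0 s g) \<partial>lborel) = 1"
    using s by (subst nn_integral_eq_integral) auto
  finally show ?thesis by (simp add: s_def)
qed

text \<open>Linearise the square through an independent standard Gaussian.\<close>

lemma (in prob_space) expectation_exp_square_le:
  fixes Z :: "'a \<Rightarrow> real"
  assumes [measurable]: "Z \<in> borel_measurable M"
    and integrable: "\<And>s. integrable M (\<lambda>x. exp (s * Z x))"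
    and mgf: "\<And>s. expectation (\<lambda>x. exp (s * Z x)) \<le> exp (s\<^sup>2 * \<tau> / 2)"
    and a: "0 \<le> a" "2 * a * \<tau> < 1"
  shows "expectation (\<lambda>x. exp (a * (Z x)\<^sup>2)) \<le> 1 / sqrt (1 - 2 * a * \<tau>)"
proof -
  have "(\<integral>\<^sup>+x. ennreal (exp (a * (Z x)\<^sup>2)) \<partial>M)
      = (\<integral>\<^sup>+x. (\<integral>\<^sup>+g. ennreal (std_normal_density g * exp (sqrt (2 * a) * Z x * g)) \<partial>lborel) \<partial>M)"
    using a by (simp add: std_normal_density_mgf power_mult_distrib)
  also have "\<dots> = (\<integral>\<^sup>+g. (\<integral>\<^sup>+x. ennreal (std_normal_density g * exp (sqrt (2 * a) * Z x * g)) \<partial>M) \<partial>lborel)"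
  proof -
    interpret pair_sigma_finite lborel M by unfold_locales
    show ?thesis by (subst Fubini') auto
  qed
  also have "\<dots> \<le> (\<integral>\<^sup>+g. ennreal (std_normal_density g * exp ((2 * a * \<tau>) * g\<^sup>2 / 2)) \<partial>lborel)"
  proof (rule nn_integral_mono)
    fix g :: real
    define s where "s = sqrt (2 * a) * g"
    have s2: "s\<^sup>2 * \<tau> / 2 = (2 * a * \<tau>) * g\<^sup>2 / 2" using a by (simp add: s_def power_mult_distrib)
    have "(\<integral>\<^sup>+x. ennreal (std_normal_density g * exp (sqrt (2 * a) * Z x * g)) \<partial>M)
        = ennreal (std_normal_density g) * (\<integral>\<^sup>+x. ennreal (exp (s * Z x)) \<partial>M)"
      by (simp add: ennreal_mult nn_integral_cmult s_def mult_ac)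
    also have "(\<integral>\<^sup>+x. ennreal (exp (s * Z x)) \<partial>M) = ennreal (expectation (\<lambda>x. exp (s * Z x)))"
      using integrable by (intro nn_integral_eq_integral) auto
    also have "\<dots> \<le> ennreal (exp (s\<^sup>2 * \<tau> / 2))" by (intro ennreal_leI mgf)
    finally show "(\<integral>\<^sup>+x. ennreal (std_normal_density g * exp (sqrt (2 * a) * Z x * g)) \<partial>M)
        \<le> ennreal (std_normal_density g * exp ((2 * a * \<tau>) * g\<^sup>2 / 2))"
      unfolding s2 by (simp add: ennreal_mult mult_left_mono)
  qed
  also have "\<dots> = ennreal (1 / sqrt (1 - 2 * a * \<tau>))"
    by (rule std_normal_density_exp_square) (use a in simp)
  finally show ?thesis by (intro integral_real_bounded) (use a in auto)
qed

section \<open>Elementary bounds for the exponential, and second moments from generating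
  functions\<close>

lemma two_plus_square_le_exp_sum: "2 + z\<^sup>2 \<le> exp z + exp (- z)" for z :: real
proof -
  \<comment> \<open>Order four is the point: in the sum of the two expansions the odd terms cancel
    and the remainder is nonnegative.\<close>
  have "\<exists>t. exp y = 1 + y + y\<^sup>2 / 2 + y ^ 3 / 6 + exp t / 24 * y ^ 4" for y :: real
    using Maclaurin_exp_le[of y 4] by (auto simp: eval_nat_numeral field_simps)
  from this[of z] this[of "- z"] obtain t t' where
    "exp z = 1 + z + z\<^sup>2 / 2 + z ^ 3 / 6 + exp t / 24 * z ^ 4"
    "exp (- z) = 1 + - z + (- z)\<^sup>2 / 2 + (- z) ^ 3 / 6 + exp t' / 24 * (- z) ^ 4" by blast
  then have "exp z + exp (- z) = 2 + z\<^sup>2 + (exp t + exp t') / 24 * z ^ 4"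
    by (simp add: field_simps)
  then show ?thesis by simp
qed

text \<open>The range is that of \<theta> d with |\<theta>| at most 0.74 and |d| at most 1/2. In the
  third-order Taylor formula exp t is at most 1/(1 - 0.37) = 100/63, so the coefficient of z^2 is at
  most 1/2 + (100/63)(37/100)/6 < 3/5.\<close>

lemma exp_le_quadratic:
  fixes z :: real
  assumes "\<bar>z\<bar> \<le> 37 / 100"
  shows "exp z \<le> 1 + z + 3 / 5 * z\<^sup>2"
proof -
  obtain t where t: "\<bar>t\<bar> \<le> \<bar>z\<bar>" "exp z = (\<Sum>m<3. z ^ m / fact m) + exp t / fact 3 * z ^ 3"
    using Maclaurin_exp_le[of z 3] by blast
  have "1 - 37 / 100 \<le> exp (- t)" using exp_ge_add_one_self[of "- t"] t assms by linarith
  then have "exp t \<le> 100 / 63" by (simp add: exp_minus field_simps)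
  moreover have "z ^ 3 \<le> 37 / 100 * z\<^sup>2"
    using assms mult_right_mono[of z "37 / 100" "z\<^sup>2"]
    by (simp add: power3_eq_cube power2_eq_square mult.assoc)
  ultimately have "exp t * z ^ 3 \<le> exp t * (37 / 100 * z\<^sup>2)" "exp t * z\<^sup>2 \<le> 100 / 63 * z\<^sup>2"
    using mult_right_mono[of "exp t" "100 / 63" "z\<^sup>2"] by simp_all
  moreover have "exp z = 1 + z + z\<^sup>2 / 2 + exp t * z ^ 3 / 6"
    using t(2) by (simp add: eval_nat_numeral field_simps)
  moreover have "0 \<le> z\<^sup>2" by simp
  ultimately show ?thesis by linarith
qed

text \<open>A lower bound for e bounds \<lambda> = 1/e from above. The quadratic Taylor polynomial
  at 1/16, raised to the power 16, is accurate enough.\<close>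

lemma exp_1_lower: "2709 / 1000 \<le> exp (1 :: real)"
proof -
  have "1 + 1 / 16 + (1 / 16)\<^sup>2 / 2 \<le> exp (1 / 16 :: real)"
    by (rule exp_lower_Taylor_quadratic) simp
  then have "(1 + 1 / 16 + (1 / 16)\<^sup>2 / 2) ^ 16 \<le> exp (1 / 16 :: real) ^ 16"
    by (intro power_mono) auto
  also have "\<dots> = exp 1" by (simp flip: exp_of_nat_mult)
  finally show ?thesis by (simp add: power2_eq_square power_divide)
qed

text \<open>Compare the terms of order s^2 in 2 + s^2 E Z^2 \<le> E (exp (s Z) + exp (- s Z)) \<le>
  2 exp (s^2 \<tau> / 2) as s tends to 0.\<close>

lemma (in prob_space) second_moment_le_of_mgf:
  fixes Z :: "'a \<Rightarrow> real"
  assumes sq: "integrable M (\<lambda>x. (Z x)\<^sup>2)"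
    and integrable: "\<And>s. integrable M (\<lambda>x. exp (s * Z x))"
    and mgf: "\<And>s. expectation (\<lambda>x. exp (s * Z x)) \<le> exp (s\<^sup>2 * \<tau> / 2)"
    and \<tau>: "\<tau> > 0"
  shows "expectation (\<lambda>x. (Z x)\<^sup>2) \<le> \<tau>"
proof -
  let ?E = "expectation (\<lambda>x. (Z x)\<^sup>2)"
  have "?E \<le> \<tau> + \<tau> * u" if u: "0 < u" "u \<le> 1" for u
  proof -
    \<comment> \<open>Chosen so that \<open>s\<^sup>2 * \<tau> / 2 = u\<close>.\<close>
    define s where "s = sqrt (2 * u / \<tau>)"
    have s2: "s\<^sup>2 = 2 * u / \<tau>" using u \<tau> by (simp add: s_def)
    have "2 + s\<^sup>2 * ?E = expectation (\<lambda>x. 2 + (s * Z x)\<^sup>2)"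
      using sq by (simp add: power_mult_distrib prob_space)
    also have "\<dots> \<le> expectation (\<lambda>x. exp (s * Z x) + exp (- s * Z x))"
      using two_plus_square_le_exp_sum[of "s * Z _"] integrable[of s] integrable[of "- s"] sq
      by (intro integral_mono) (auto simp: power_mult_distrib)
    also have "\<dots> \<le> 2 * exp u"
      using mgf[of s] mgf[of "- s"] integrable[of s] integrable[of "- s"] s2 \<tau> by simp
    also have "\<dots> \<le> 2 * (1 + u + u\<^sup>2)" using exp_bound[of u] u by simp
    finally have "2 * u / \<tau> * ?E \<le> 2 * u / \<tau> * (\<tau> + \<tau> * u)" unfolding s2 using \<tau>
      by (simp add: power2_eq_square field_simps)
    then show ?thesis using u \<tau> by (subst (asm) mult_le_cancel_left_pos) auto
  qed
  \<comment> \<open>Here \<open>e\<close> is an arbitrary positive error, not Euler's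
    number.\<close>
  from this[of "min 1 (e / \<tau>)" for e] have "?E \<le> \<tau> + e" if "e > 0" for e
    using that \<tau> by (smt (verit) divide_pos_pos min_def mult.commute nonzero_eq_divide_eq mult_left_mono)
  then show ?thesis by (rule field_le_epsilon)
qed

section \<open>Bounded differences on an infinite product\<close>

text \<open>Since the space is the whole type, an updated point \<open>w(k := x)\<close> never
  leaves it, and bounds can be demanded at every point.\<close>

locale iid_product = prob_space \<mu> for \<mu> :: "'a measure" +
  assumes space_mu [simp]: "space \<mu> = UNIV"
begin

definition P :: "(nat \<Rightarrow> 'a) measure" where
  "P = PiM UNIV (\<lambda>_. \<mu>)"

text \<open>A bound at every point, and not merely almost everywhere, survives the freezing of a
  coordinate.\<close>

definition bmeas :: "((nat \<Rightarrow> 'a) \<Rightarrow> real) \<Rightarrow> bool" where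
  "bmeas f \<longleftrightarrow> f \<in> borel_measurable P \<and> (\<exists>B. \<forall>w. \<bar>f w\<bar> \<le> B)"

text \<open>An explicit version of the conditional expectation given all coordinates except
  \<open>k\<close>.\<close>

definition avg :: "nat \<Rightarrow> ((nat \<Rightarrow> 'a) \<Rightarrow> real) \<Rightarrow> (nat \<Rightarrow> 'a) \<Rightarrow> real" where
  "avg k f w = (\<integral>x. f (w(k := x)) \<partial>\<mu>)"

definition depends :: "nat set \<Rightarrow> ((nat \<Rightarrow> 'a) \<Rightarrow> real) \<Rightarrow> bool" where
  "depends A f \<longleftrightarrow> (\<forall>w w'. (\<forall>i\<in>A. w i = w' i) \<longrightarrow> f w = f w')"

sublocale P: prob_space P
  unfolding P_def by (intro prob_space_PiM) unfold_locales

lemma measure_mu_UNIV [simp]: "measure \<mu> UNIV = 1"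
  using prob_space by simp

lemma space_P [simp]: "space P = UNIV"
  by (simp add: P_def space_PiM PiE_def extensional_def)

lemma sets_P: "sets P = sets (PiM UNIV (\<lambda>_. \<mu>))"
  by (simp add: P_def)

lemma measurable_upd_pair: "(\<lambda>(x, w). w(k := x)) \<in> \<mu> \<Otimes>\<^sub>M P \<rightarrow>\<^sub>M P"
  unfolding P_def
  by (rule measurable_PiM_single') (auto simp: split_beta' space_pair_measure)

lemma measurable_upd [measurable]:
  "(\<lambda>w. w(k := x)) \<in> P \<rightarrow>\<^sub>M P" "(\<lambda>x. w(k := x)) \<in> \<mu> \<rightarrow>\<^sub>M P"
  using measurable_compose[OF measurable_Pair1' measurable_upd_pair[of k], of x]
    measurable_compose[OF measurable_Pair2' measurable_upd_pair[of k], of w]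
  by (auto simp: comp_def)

text \<open>Resampling one coordinate does not change the law. Together with Fubini's theorem this
  yields \<open>integral_split\<close> and \<open>integral_avg\<close>.\<close>

lemma distr_upd: "distr (\<mu> \<Otimes>\<^sub>M P) P (\<lambda>(x, w). w(k := x)) = P"
  using distr_pair_PiM_eq_PiM[of UNIV "\<lambda>_. \<mu>" k] prob_space_axioms by (simp add: P_def)

lemma bmeasD [measurable_dest]: "bmeas f \<Longrightarrow> f \<in> borel_measurable P"
  by (simp add: bmeas_def)

lemma bmeasE: assumes "bmeas f" obtains B where "\<And>w. \<bar>f w\<bar> \<le> B"
  using assms by (auto simp: bmeas_def)

lemma bmeas_integrable: "bmeas f \<Longrightarrow> integrable P f"
  by (auto simp: bmeas_def intro!: P.integrable_const_bound AE_I2)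

lemma bmeas_const [intro, simp]: "bmeas (\<lambda>_. c)"
  by (auto simp: bmeas_def)

lemma bmeas_add [intro]: "bmeas f \<Longrightarrow> bmeas g \<Longrightarrow> bmeas (\<lambda>w. f w + g w)"
  unfolding bmeas_def
proof (elim conjE exE, intro conjI)
  fix B C assume "\<forall>w. \<bar>f w\<bar> \<le> B" "\<forall>w. \<bar>g w\<bar> \<le> C"
  then show "\<exists>B. \<forall>w. \<bar>f w + g w\<bar> \<le> B"
    by (intro exI[of _ "B + C"]) (meson abs_triangle_ineq add_mono order_trans)
qed simp_all

lemma bmeas_mult [intro]: "bmeas f \<Longrightarrow> bmeas g \<Longrightarrow> bmeas (\<lambda>w. f w * g w)"
  unfolding bmeas_def
proof (elim conjE exE, intro conjI)
  fix B C assume *: "\<forall>w. \<bar>f w\<bar> \<le> B" "\<forall>w. \<bar>g w\<bar> \<le> C"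
  then have "0 \<le> B" by (meson abs_ge_zero order_trans)
  with * show "\<exists>B. \<forall>w. \<bar>f w * g w\<bar> \<le> B"
    by (intro exI[of _ "B * C"]) (auto simp: abs_mult intro!: mult_mono)
qed simp_all

lemma bmeas_uminus [intro]: "bmeas f \<Longrightarrow> bmeas (\<lambda>w. - f w)"
  by (auto simp: bmeas_def)

lemma bmeas_diff [intro]: "bmeas f \<Longrightarrow> bmeas g \<Longrightarrow> bmeas (\<lambda>w. f w - g w)"
  using bmeas_add[OF _ bmeas_uminus, of f g] by simp

lemma bmeas_power2 [intro]: "bmeas f \<Longrightarrow> bmeas (\<lambda>w. (f w)\<^sup>2)"
  unfolding power2_eq_square by (rule bmeas_mult)

lemma bmeas_sum [intro]: "(\<And>i. i \<in> I \<Longrightarrow> bmeas (f i)) \<Longrightarrow> bmeas (\<lambda>w. \<Sum>i\<in>I. f i w)"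
  by (induction I rule: infinite_finite_induct) auto

lemma bmeas_divide [intro]: "bmeas f \<Longrightarrow> bmeas (\<lambda>w. f w / c)"
  using bmeas_mult[of f "\<lambda>_. inverse c"] by (simp add: divide_inverse)

lemma bmeas_exp [intro]: "bmeas f \<Longrightarrow> bmeas (\<lambda>w. exp (f w))"
  unfolding bmeas_def
proof (elim conjE exE, intro conjI)
  fix B assume "\<forall>w. \<bar>f w\<bar> \<le> B"
  then show "\<exists>B. \<forall>w. \<bar>exp (f w)\<bar> \<le> B"
    by (intro exI[of _ "exp B"]) (auto simp: abs_le_iff)
qed simp_all

lemmas bmeas_intros = bmeas_const bmeas_add bmeas_mult bmeas_diff bmeas_uminus bmeas_power2
  bmeas_sum bmeas_divide bmeas_exp

lemma bmeas_upd [intro]: "bmeas f \<Longrightarrow> bmeas (\<lambda>w. f (w(k := x)))"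
  by (auto simp: bmeas_def intro: measurable_compose[OF measurable_upd(1)])

lemma bmeas_upd_measurable: "bmeas f \<Longrightarrow> (\<lambda>x. f (w(k := x))) \<in> borel_measurable \<mu>"
  by (auto intro: measurable_compose[OF measurable_upd(2)])

lemma bmeas_upd_integrable: "bmeas f \<Longrightarrow> integrable \<mu> (\<lambda>x. f (w(k := x)))"
proof -
  assume f: "bmeas f"
  then obtain B where "\<And>w. \<bar>f w\<bar> \<le> B" by (rule bmeasE) blast
  then show ?thesis
    using bmeas_upd_measurable[OF f, of w k] by (intro integrable_const_bound[where B = B]) auto
qed

lemma bmeas_pair_measurable: 
  assumes "bmeas f" shows "(\<lambda>(x, w). f (w(k := x))) \<in> borel_measurable (\<mu> \<Otimes>\<^sub>M P)"
  using measurable_compose[OF measurable_upd_pair[of k] bmeasD[OF assms]] by (simp add: split_beta')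

lemma bmeas_avg [intro]:
  assumes "bmeas f" shows "bmeas (avg k f)"
proof -
  obtain B where B: "\<And>w. \<bar>f w\<bar> \<le> B" using bmeasE[OF assms] by blast
  have "(\<lambda>(w, x). f (w(k := x))) \<in> borel_measurable (P \<Otimes>\<^sub>M \<mu>)"
    using measurable_compose[OF measurable_pair_swap' bmeas_pair_measurable[OF assms, of k]]
    by (simp add: split_beta')
  then have "(\<lambda>w. \<integral>x. f (w(k := x)) \<partial>\<mu>) \<in> borel_measurable P"
    using borel_measurable_lebesgue_integral by simp
  moreover have "\<bar>avg k f w\<bar> \<le> B" for w
    unfolding avg_def using bmeas_upd_integrable[OF assms] B by (rule abs_expectation_le)
  ultimately show ?thesis by (auto simp: bmeas_def avg_def[abs_def])
qed

lemma
  assumes "bmeas f"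
  shows integral_split: "integral\<^sup>L P f = (\<integral>x. (\<integral>w. f (w(k := x)) \<partial>P) \<partial>\<mu>)"
    and integral_avg: "integral\<^sup>L P (avg k f) = integral\<^sup>L P f"
    and integral_split_integrable: "integrable \<mu> (\<lambda>x. \<integral>w. f (w(k := x)) \<partial>P)"
proof -
  interpret Q: pair_sigma_finite \<mu> P by unfold_locales
  interpret Q': pair_prob_space \<mu> P by unfold_locales
  obtain B where B: "\<And>w. \<bar>f w\<bar> \<le> B" using bmeasE[OF assms] by blast
  have int: "integrable (\<mu> \<Otimes>\<^sub>M P) (\<lambda>(x, w). f (w(k := x)))"
    using bmeas_pair_measurable[OF assms, of k] B
    by (intro Q'.integrable_const_bound[where B=B]) auto
  have "integral\<^sup>L P f = integral\<^sup>L (distr (\<mu> \<Otimes>\<^sub>M P) P (\<lambda>(x, w). w(k := x))) f"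
    by (simp only: distr_upd)
  also have "\<dots> = (\<integral>z. f ((\<lambda>(x, w). w(k := x)) z) \<partial>(\<mu> \<Otimes>\<^sub>M P))"
    using assms by (intro integral_distr measurable_upd_pair) auto
  also have "\<dots> = (\<integral>(x, w). f (w(k := x)) \<partial>(\<mu> \<Otimes>\<^sub>M P))" by (simp add: split_beta')
  finally have eq: "integral\<^sup>L P f = (\<integral>(x, w). f (w(k := x)) \<partial>(\<mu> \<Otimes>\<^sub>M P))" .
  show "integral\<^sup>L P f = (\<integral>x. (\<integral>w. f (w(k := x)) \<partial>P) \<partial>\<mu>)"
    unfolding eq using Q.integral_fst[OF int] by simp
  show "integral\<^sup>L P (avg k f) = integral\<^sup>L P f"
    unfolding eq avg_def using Q.integral_snd[OF int] by simp
  show "integrable \<mu> (\<lambda>x. \<integral>w. f (w(k := x)) \<partial>P)"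
    using Q.integrable_fst[OF int] by simp
qed

lemma dependsD: "depends A f \<Longrightarrow> (\<And>i. i \<in> A \<Longrightarrow> w i = w' i) \<Longrightarrow> f w = f w'"
  by (auto simp: depends_def)

lemma depends_mono: "depends A f \<Longrightarrow> A \<subseteq> B \<Longrightarrow> depends B f"
  unfolding depends_def by blast

lemma depends_avg: "depends A f \<Longrightarrow> depends (A - {k}) (avg k f)"
  unfolding depends_def avg_def by (auto intro!: Bochner_Integration.integral_cong)

lemma depends_avg_Suc: "depends {1..Suc n} f \<Longrightarrow> depends {1..n} (avg (Suc n) f)"
  using depends_avg[of "{1..Suc n}" f "Suc n"] by (rule depends_mono) auto

lemma depends_upd: "depends A f \<Longrightarrow> k \<notin> A \<Longrightarrow> f (w(k := x)) = f w"
  by (rule dependsD) auto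

lemma avg_upd [simp]: "avg k f (w(k := x)) = avg k f w"
  by (simp add: avg_def)

lemma depends_empty: "depends {} f \<Longrightarrow> f w = integral\<^sup>L P f"
proof -
  assume "depends {} f"
  then have "f = (\<lambda>_. f w)" by (intro ext) (auto intro: dependsD)
  then show ?thesis by (metis P.prob_space lebesgue_integral_const scaleR_one)
qed

text \<open>McDiarmid's argument for generating functions: integrating out the last coordinate costs
  the factor of Hoeffding's lemma, and averaging does not increase the oscillations in the other
  coordinates.\<close>

lemma bounded_differences_mgf:
  assumes "bmeas f" "depends {1..n} f"
    and "\<And>i w x y. i \<in> {1..n} \<Longrightarrow> \<bar>f (w(i := x)) - f (w(i := y))\<bar> \<le> c i"
  shows "(\<integral>w. exp (s * (f w - integral\<^sup>L P f)) \<partial>P) \<le> exp (s\<^sup>2 * (\<Sum>i=1..n. (c i)\<^sup>2) / 8)"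
  using assms
proof (induction n arbitrary: f)
  case 0
  then have "f w = integral\<^sup>L P f" for w by (intro depends_empty) simp
  then show ?case using P.prob_space by simp
next
  case (Suc n)
  let ?k = "Suc n"
  define f' where "f' = avg ?k f"
  have bf: "bmeas f" and bf': "bmeas f'" using Suc.prems(1) by (auto simp: f'_def)
  define m where "m = integral\<^sup>L P f"
  have m': "integral\<^sup>L P f' = m" unfolding f'_def m_def by (rule integral_avg) fact
  have IH: "(\<integral>w. exp (s * (f' w - m)) \<partial>P) \<le> exp (s\<^sup>2 * (\<Sum>i=1..n. (c i)\<^sup>2) / 8)"
    unfolding m'[symmetric]
  proof (rule Suc.IH[OF bf'])
    show "depends {1..n} f'" unfolding f'_def by (rule depends_avg_Suc) fact
    fix i w x y assume i: "i \<in> {1..n}"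
    then have ne: "i \<noteq> ?k" by auto
    have "\<bar>f' (w(i := x)) - f' (w(i := y))\<bar>
        = \<bar>\<integral>z. f ((w(?k := z))(i := x)) - f ((w(?k := z))(i := y)) \<partial>\<mu>\<bar>"
      unfolding f'_def avg_def using ne
      by (subst Bochner_Integration.integral_diff)
         (auto simp: fun_upd_twist intro: bmeas_upd_integrable[OF bf])
    also have "\<dots> \<le> c i"
      by (intro abs_expectation_le Bochner_Integration.integrable_diff
            bmeas_upd_integrable[OF bmeas_upd[OF bf]] Suc.prems(3)) (use i in simp)
    finally show "\<bar>f' (w(i := x)) - f' (w(i := y))\<bar> \<le> c i" .
  qed
  have be: "bmeas (\<lambda>w. exp (s * (f w - m)))" by (intro bmeas_intros bf)
  have "(\<integral>w. exp (s * (f w - m)) \<partial>P) = (\<integral>w. avg ?k (\<lambda>w. exp (s * (f w - m))) w \<partial>P)"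
    by (rule integral_avg[symmetric]) fact
  also have "\<dots> \<le> (\<integral>w. exp (s\<^sup>2 * (c ?k)\<^sup>2 / 8) * exp (s * (f' w - m)) \<partial>P)"
  proof (rule integral_mono)
    show "integrable P (avg ?k (\<lambda>w. exp (s * (f w - m))))" using be by (intro bmeas_integrable) auto
    show "integrable P (\<lambda>w. exp (s\<^sup>2 * (c ?k)\<^sup>2 / 8) * exp (s * (f' w - m)))"
      by (intro bmeas_integrable bmeas_intros bf')
    fix w
    have "avg ?k (\<lambda>w. exp (s * (f w - m))) w
        = (\<integral>x. exp (s * (f' w - m)) * exp (s * (f (w(?k := x)) - f' w)) \<partial>\<mu>)"
      unfolding avg_def by (simp add: mult_exp_exp algebra_simps)
    also have "\<dots> = exp (s * (f' w - m)) * (\<integral>x. exp (s * (f (w(?k := x)) - f' w)) \<partial>\<mu>)"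
      by simp
    also have "(\<integral>x. exp (s * (f (w(?k := x)) - f' w)) \<partial>\<mu>) \<le> exp (s\<^sup>2 * (c ?k)\<^sup>2 / 8)"
      unfolding f'_def avg_def
      by (intro mgf_le_of_oscillation bmeas_upd_measurable[OF bf] Suc.prems(3)) simp
    finally show "avg ?k (\<lambda>w. exp (s * (f w - m))) w \<le> exp (s\<^sup>2 * (c ?k)\<^sup>2 / 8) * exp (s * (f' w - m))"
      by (simp add: mult.commute)
  qed
  also have "\<dots> = exp (s\<^sup>2 * (c ?k)\<^sup>2 / 8) * (\<integral>w. exp (s * (f' w - m)) \<partial>P)" by simp
  also have "\<dots> \<le> exp (s\<^sup>2 * (c ?k)\<^sup>2 / 8) * exp (s\<^sup>2 * (\<Sum>i=1..n. (c i)\<^sup>2) / 8)"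
    by (intro mult_left_mono IH) simp
  also have "\<dots> = exp (s\<^sup>2 * (\<Sum>i=1..Suc n. (c i)\<^sup>2) / 8)"
    by (simp add: mult_exp_exp field_simps)
  finally show ?case unfolding m_def .
qed

end

context iid_product
begin

lemma avg_upd_commute: "j \<noteq> k \<Longrightarrow> avg k f (w(j := x)) = avg k (\<lambda>w. f (w(j := x))) w"
  by (simp add: avg_def fun_upd_twist)

lemma avg_diff: "bmeas f \<Longrightarrow> bmeas g \<Longrightarrow> avg k (\<lambda>w. f w - g w) w = avg k f w - avg k g w"
  by (simp add: avg_def bmeas_upd_integrable)

lemma avg_mono: "bmeas f \<Longrightarrow> bmeas g \<Longrightarrow> (\<And>w. f w \<le> g w) \<Longrightarrow> avg k f w \<le> avg k g w"
  unfolding avg_def by (intro integral_mono bmeas_upd_integrable) auto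

lemma avg_abs_le:
  assumes "bmeas f" "\<And>w. \<bar>f w\<bar> \<le> c" shows "\<bar>avg k f w\<bar> \<le> c"
  unfolding avg_def using bmeas_upd_integrable assms by (intro abs_expectation_le) auto

lemma avg_mult_left:
  assumes "depends A f" "k \<notin> A" shows "avg k (\<lambda>w. f w * g w) w = f w * avg k g w"
  using depends_upd[OF assms] by (simp add: avg_def)

end

section \<open>Exponential moments of degenerate statistics\<close>

text \<open>The last hypothesis says that the first-order Hoeffding projections vanish. The
  constants are those of S_n / (2 A p^2 n^(p-1)), with 1/p weakened to 1/2, as p is at least 2 in
  the case of interest.\<close>

locale degenerate_statistic = iid_product +
  fixes F :: "(nat \<Rightarrow> 'a) \<Rightarrow> real" and n :: nat
  assumes F_bmeas: "bmeas F"
    and F_depends: "depends {1..n} F"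
    and n_pos: "n > 0"
    and first_difference: "\<And>i w x y. i \<in> {1..n} \<Longrightarrow> \<bar>F (w(i := x)) - F (w(i := y))\<bar> \<le> 1 / 2"
    and second_difference: "\<And>i j w x y u v. i \<in> {1..n} \<Longrightarrow> j \<in> {1..n} \<Longrightarrow> i \<noteq> j \<Longrightarrow>
      \<bar>(F (w(i := x, j := u)) - F (w(i := y, j := u))) - (F (w(i := x, j := v)) - F (w(i := y, j := v)))\<bar>
        \<le> 2 / real n"
    and degenerate: "\<And>i x. i \<in> {1..n} \<Longrightarrow> (\<integral>w. F (w(i := x)) \<partial>P) = integral\<^sup>L P F"
begin

text \<open>Coordinates are integrated out from \<open>n\<close> downwards, against the direction of
  the filtration; \<open>proj\<close> reverses the index.\<close>

primrec avg_top :: "nat \<Rightarrow> (nat \<Rightarrow> 'a) \<Rightarrow> real" where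
  "avg_top 0 = F"
| "avg_top (Suc j) = avg (n - j) (avg_top j)"

text \<open>The conditional expectation of \<^term>\<open>F\<close> given the coordinates \<open>1, \<dots>, k\<close>.\<close>

definition proj :: "nat \<Rightarrow> (nat \<Rightarrow> 'a) \<Rightarrow> real" where
  "proj k = avg_top (n - k)"

abbreviation mean :: real where "mean \<equiv> integral\<^sup>L P F"

lemma proj_n [simp]: "proj n = F"
  by (simp add: proj_def)

lemma proj_avg: "k < n \<Longrightarrow> proj k = avg (Suc k) (proj (Suc k))"
  using avg_top.simps(2)[of "n - Suc k"] by (simp add: proj_def Suc_diff_Suc)

lemma proj_bmeas [intro, simp]: "k \<le> n \<Longrightarrow> bmeas (proj k)"
  by (induction rule: inc_induct) (auto simp: F_bmeas proj_avg)

lemma proj_depends: "k \<le> n \<Longrightarrow> depends {1..k} (proj k)"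
proof (induction rule: inc_induct)
  case (step k)
  then show ?case using depends_avg_Suc by (simp only: proj_avg)
qed (use F_depends in simp)

lemma integral_proj: "k \<le> n \<Longrightarrow> integral\<^sup>L P (proj k) = mean"
  by (induction rule: inc_induct) (auto simp: proj_avg integral_avg)

lemma proj_0: "proj 0 w = mean"
  using depends_empty[of "proj 0" w] proj_depends[of 0] integral_proj[of 0] by simp

text \<open>Freezing coordinate \<open>i\<close> commutes with integrating out a later one, so
  degeneracy descends from \<open>F\<close> along the martingale.\<close>

lemma proj_degenerate:
  assumes "k \<le> n" "i \<in> {1..k}"
  shows "(\<integral>w. proj k (w(i := x)) \<partial>P) = mean"
  using assms
proof (induction rule: inc_induct)
  case (step k)
  then have ne: "i \<noteq> Suc k" by auto
  have "(\<integral>w. proj k (w(i := x)) \<partial>P) = (\<integral>w. avg (Suc k) (\<lambda>w. proj (Suc k) (w(i := x))) w \<partial>P)"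
    using step.hyps ne by (simp add: proj_avg avg_upd_commute)
  also have "\<dots> = (\<integral>w. proj (Suc k) (w(i := x)) \<partial>P)"
    using step.hyps by (intro integral_avg) auto
  also have "\<dots> = mean" using step.prems by (intro step.IH) auto
  finally show ?case .
qed (simp add: degenerate)

lemma proj_first_difference:
  assumes "k \<le> n" "i \<in> {1..k}"
  shows "\<bar>proj k (w(i := x)) - proj k (w(i := y))\<bar> \<le> 1 / 2"
  using assms
proof (induction arbitrary: w rule: inc_induct)
  case (step k)
  then have ne: "i \<noteq> Suc k" and i: "i \<in> {1..Suc k}" by auto
  have b: "bmeas (proj (Suc k))" using step.hyps by simp
  have "proj k (w(i := x)) - proj k (w(i := y))
      = avg (Suc k) (\<lambda>w. proj (Suc k) (w(i := x)) - proj (Suc k) (w(i := y))) w"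
    using step.hyps ne b by (simp add: proj_avg avg_upd_commute avg_diff bmeas_upd)
  also have "\<bar>\<dots>\<bar> \<le> 1 / 2" by (intro avg_abs_le bmeas_diff bmeas_upd b step.IH i)
  finally show ?case .
next
  case base
  then show ?case unfolding proj_n by (rule first_difference)
qed

lemma proj_second_difference:
  assumes "k \<le> n" "i \<in> {1..k}" "j \<in> {1..k}" "i \<noteq> j"
  shows "\<bar>(proj k (w(i := x, j := u)) - proj k (w(i := y, j := u)))
    - (proj k (w(i := x, j := v)) - proj k (w(i := y, j := v)))\<bar> \<le> 2 / real n"
  using assms
proof (induction arbitrary: w rule: inc_induct)
  case (step k)
  then have ne: "i \<noteq> Suc k" "j \<noteq> Suc k" and ij: "i \<in> {1..Suc k}" "j \<in> {1..Suc k}" by auto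
  have b: "bmeas (proj (Suc k))" using step.hyps by simp
  have "bmeas (\<lambda>w. proj (Suc k) (w(i := x, j := u)))" for x u
    using bmeas_upd[OF bmeas_upd[OF b, of j u], of i x] by simp
  note b' = this this[THEN bmeas_diff[OF this]]
  have "(proj k (w(i := x, j := u)) - proj k (w(i := y, j := u)))
      - (proj k (w(i := x, j := v)) - proj k (w(i := y, j := v)))
      = avg (Suc k) (\<lambda>w. (proj (Suc k) (w(i := x, j := u)) - proj (Suc k) (w(i := y, j := u)))
      - (proj (Suc k) (w(i := x, j := v)) - proj (Suc k) (w(i := y, j := v)))) w"
    using step.hyps ne b' by (simp add: proj_avg avg_upd_commute avg_diff)
  also have "\<bar>\<dots>\<bar> \<le> 2 / real n"
    by (intro avg_abs_le bmeas_diff b' step.IH ij \<open>i \<noteq> j\<close>)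
  finally show ?case .
next
  case base
  then show ?case unfolding proj_n by (rule second_difference)
qed

text \<open>Shifted by one: \<open>incr k\<close> is the increment that reveals coordinate
  \<open>Suc k\<close>, so \<open>k\<close> runs from 0 to \<open>n - 1\<close>.\<close>

definition incr :: "nat \<Rightarrow> (nat \<Rightarrow> 'a) \<Rightarrow> real" where
  "incr k w = proj (Suc k) w - proj k w"

lemma incr_bmeas [intro, simp]: "k < n \<Longrightarrow> bmeas (incr k)"
  unfolding incr_def[abs_def] by (intro bmeas_diff) auto

lemma proj_upd_Suc: "k < n \<Longrightarrow> proj k (w(Suc k := x)) = proj k w"
  by (simp add: proj_avg)

lemma avg_incr: "k < n \<Longrightarrow> avg (Suc k) (incr k) w = 0"
  unfolding incr_def[abs_def] by (simp add: avg_diff avg_def[of "Suc k" "proj k"] proj_upd_Suc)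
    (simp add: proj_avg)

lemma incr_abs_le:
  assumes k: "k < n" shows "\<bar>incr k w\<bar> \<le> 1 / 2"
proof -
  \<comment> \<open>\<open>w(Suc k := w (Suc k))\<close> is \<open>w\<close> itself, written as an
    update so that the first difference bound applies.\<close>
  have "incr k w = avg (Suc k) (\<lambda>v. proj (Suc k) (w(Suc k := w (Suc k))) - proj (Suc k) (w(Suc k := v (Suc k)))) w"
    using k bmeas_upd_integrable[of "proj (Suc k)"] by (simp add: incr_def proj_avg avg_def)
  also have "\<dots> = (\<integral>x. proj (Suc k) (w(Suc k := w (Suc k))) - proj (Suc k) (w(Suc k := x)) \<partial>\<mu>)"
    by (simp add: avg_def)
  also have "\<bar>\<dots>\<bar> \<le> 1 / 2"
    using k bmeas_upd_integrable[of "proj (Suc k)"] proj_first_difference[of "Suc k" "Suc k" w "w (Suc k)"]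
    by (intro abs_expectation_le) auto
  finally show ?thesis .
qed

text \<open>The conditioning is the reverse of the usual one: the newest coordinate is frozen and
  the older ones stay random. The at most n older coordinates, each with oscillation 2/n, give the
  exponent s^2 n (2/n)^2 / 8 = s^2 / (2 n) in \<open>bounded_differences_mgf\<close>.\<close>

lemma incr_upd_mgf:
  assumes k: "k < n"
  shows "(\<integral>w. exp (s * incr k (w(Suc k := x))) \<partial>P) \<le> exp (s\<^sup>2 * (1 / real n) / 2)"
proof -
  define Z where "Z = (\<lambda>w. incr k (w(Suc k := x)))"
  have Z: "bmeas Z" unfolding Z_def using k by (intro bmeas_upd) simp
  have "integral\<^sup>L P Z = (\<integral>w. proj (Suc k) (w(Suc k := x)) \<partial>P) - integral\<^sup>L P (proj k)"
    unfolding Z_def incr_def using k bmeas_integrable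
    by (simp add: proj_upd_Suc bmeas_upd)
  also have "\<dots> = 0" using k by (simp add: proj_degenerate integral_proj)
  finally have mean0: "integral\<^sup>L P Z = 0" .
  have dep: "depends {1..k} Z"
    unfolding depends_def
  proof (intro allI impI)
    fix w w' :: "nat \<Rightarrow> 'a" assume eq: "\<forall>i\<in>{1..k}. w i = w' i"
    have "proj (Suc k) (w(Suc k := x)) = proj (Suc k) (w'(Suc k := x))"
      using k eq by (intro dependsD[OF proj_depends[of "Suc k"]]) auto
    moreover have "proj k w = proj k w'"
      using k eq by (intro dependsD[OF proj_depends[of k]]) auto
    ultimately show "Z w = Z w'" using k by (simp add: Z_def incr_def proj_upd_Suc)
  qed
  have osc: "\<bar>Z (w(i := a)) - Z (w(i := b))\<bar> \<le> 2 / real n" if i: "i \<in> {1..k}" for i w a b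
  proof -
    have ne: "i \<noteq> Suc k" using i by auto
    let ?f = "proj (Suc k)"
    have int: "integrable \<mu> (\<lambda>z. ?f (w(i := c, Suc k := z)))" for c
      using k by (intro bmeas_upd_integrable) simp
    have p: "proj k (w(i := c)) = (\<integral>z. ?f (w(i := c, Suc k := z)) \<partial>\<mu>)" for c
      using k by (simp add: proj_avg avg_def)
    have "Z (w(i := a)) - Z (w(i := b))
        = (?f (w(i := a, Suc k := x)) - ?f (w(i := b, Suc k := x))) - (proj k (w(i := a)) - proj k (w(i := b)))"
      using k by (simp add: Z_def incr_def proj_upd_Suc)
    \<comment> \<open>As \<open>proj k\<close> averages \<open>proj (Suc k)\<close> over the new
      coordinate z, the difference is an average of mixed second differences in the coordinates
      \<open>i\<close> and \<open>Suc k\<close>.\<close>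
    also have "\<dots> = (\<integral>z. (?f (w(i := a, Suc k := x)) - ?f (w(i := b, Suc k := x)))
        - (?f (w(i := a, Suc k := z)) - ?f (w(i := b, Suc k := z))) \<partial>\<mu>)"
      unfolding p using int by simp
    also have "\<bar>\<dots>\<bar> \<le> 2 / real n"
      using int k i ne proj_second_difference[of "Suc k" i "Suc k" w a x b]
      by (intro abs_expectation_le) auto
    finally show ?thesis .
  qed
  have "(\<integral>w. exp (s * Z w) \<partial>P) \<le> exp (s\<^sup>2 * (\<Sum>i=1..k. (2 / real n)\<^sup>2) / 8)"
    using bounded_differences_mgf[OF Z dep osc, of s] unfolding mean0 by simp
  also have "\<dots> \<le> exp (s\<^sup>2 * (1 / real n) / 2)"
  proof -
    have "real k * (2 / real n)\<^sup>2 \<le> real n * (2 / real n)\<^sup>2" using k by (intro mult_right_mono) auto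
    also have "\<dots> = 4 / real n" using n_pos by (simp add: power2_eq_square)
    finally have "s\<^sup>2 * (real k * (2 / real n)\<^sup>2) / 8 \<le> s\<^sup>2 * (4 / real n) / 8"
      by (intro divide_right_mono mult_left_mono) auto
    then show ?thesis by (simp only: exp_le_cancel_iff sum_constant card_atLeastAtMost) simp
  qed
  finally show ?thesis unfolding Z_def .
qed

text \<open>The bound for a frozen newest coordinate is uniform in its value x, so it survives
  integration over x. The factor n compensates the variance proxy 1/n.\<close>

lemma incr_exp_square:
  assumes k: "k < n" and a: "0 \<le> a" "2 * a < 1"
  shows "(\<integral>w. exp (real n * a * (incr k w)\<^sup>2) \<partial>P) \<le> 1 / sqrt (1 - 2 * a)"
proof -
  have b: "bmeas (\<lambda>w. exp (real n * a * (incr k w)\<^sup>2))" by (intro bmeas_intros incr_bmeas k)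
  have "(\<integral>w. exp (real n * a * (incr k w)\<^sup>2) \<partial>P)
      = (\<integral>x. (\<integral>w. exp (real n * a * (incr k (w(Suc k := x)))\<^sup>2) \<partial>P) \<partial>\<mu>)"
    by (rule integral_split[OF b])
  also have "\<dots> \<le> (\<integral>x. 1 / sqrt (1 - 2 * a) \<partial>\<mu>)"
  proof (rule integral_mono[OF integral_split_integrable[OF b]])
    fix x
    have Z: "bmeas (\<lambda>w. incr k (w(Suc k := x)))" using k by auto
    have "(\<integral>w. exp (real n * a * (incr k (w(Suc k := x)))\<^sup>2) \<partial>P)
        \<le> 1 / sqrt (1 - 2 * (real n * a) * (1 / real n))"
      using n_pos a Z incr_upd_mgf[OF k, of _ x]
      by (intro P.expectation_exp_square_le bmeas_integrable bmeas_exp bmeas_mult) auto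
    then show "(\<integral>w. exp (real n * a * (incr k (w(Suc k := x)))\<^sup>2) \<partial>P) \<le> 1 / sqrt (1 - 2 * a)"
      using n_pos by simp
  qed simp
  finally show ?thesis by simp
qed

lemma incr_second_moment:
  assumes k: "k < n" shows "(\<integral>w. (incr k w)\<^sup>2 \<partial>P) \<le> 1 / real n"
proof -
  have b: "bmeas (\<lambda>w. (incr k w)\<^sup>2)" by (intro bmeas_intros incr_bmeas k)
  have "(\<integral>w. (incr k w)\<^sup>2 \<partial>P) = (\<integral>x. (\<integral>w. (incr k (w(Suc k := x)))\<^sup>2 \<partial>P) \<partial>\<mu>)"
    by (rule integral_split[OF b])
  also have "\<dots> \<le> (\<integral>x. 1 / real n \<partial>\<mu>)"
  proof (rule integral_mono[OF integral_split_integrable[OF b]])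
    fix x
    have Z: "bmeas (\<lambda>w. incr k (w(Suc k := x)))" using k by auto
    show "(\<integral>w. (incr k (w(Suc k := x)))\<^sup>2 \<partial>P) \<le> 1 / real n"
      using n_pos Z incr_upd_mgf[OF k, of _ x]
      by (intro P.second_moment_le_of_mgf bmeas_integrable bmeas_exp bmeas_mult bmeas_power2) auto
  qed simp
  finally show ?thesis by simp
qed

text \<open>Martingale increments are orthogonal, so their n second moments add up, and each is at
  most 1/n.\<close>

lemma variance_le_1: "(\<integral>w. (F w - mean)\<^sup>2 \<partial>P) \<le> 1"
proof -
  have "(\<integral>w. (proj k w - mean)\<^sup>2 \<partial>P) \<le> real k / real n" if "k \<le> n" for k
    using that
  proof (induction k)
    case 0
    then show ?case by (simp add: proj_0)
  next
    case (Suc k)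
    then have k: "k < n" by simp
    have b: "bmeas (proj k)" "bmeas (incr k)" using k by auto
    have ort: "(\<integral>w. (proj k w - mean) * incr k w \<partial>P) = 0"
    proof -
      have "avg (Suc k) (\<lambda>w. (proj k w - mean) * incr k w) = (\<lambda>_. 0)"
        using k by (intro ext, subst avg_mult_left[where A = "- {Suc k}"])
          (auto simp: avg_incr depends_def intro!: dependsD[OF proj_depends])
      moreover have "integral\<^sup>L P (avg (Suc k) (\<lambda>w. (proj k w - mean) * incr k w))
          = (\<integral>w. (proj k w - mean) * incr k w \<partial>P)"
        by (intro integral_avg bmeas_intros b)
      ultimately show ?thesis by simp
    qed
    have "(proj (Suc k) w - mean)\<^sup>2 = (proj k w - mean)\<^sup>2 + 2 * ((proj k w - mean) * incr k w) + (incr k w)\<^sup>2" for w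
      by (simp add: incr_def power2_eq_square algebra_simps)
    then have "(\<integral>w. (proj (Suc k) w - mean)\<^sup>2 \<partial>P)
        = (\<integral>w. (proj k w - mean)\<^sup>2 \<partial>P) + 2 * (\<integral>w. (proj k w - mean) * incr k w \<partial>P) + (\<integral>w. (incr k w)\<^sup>2 \<partial>P)"
      using b by (simp add: bmeas_integrable bmeas_diff bmeas_mult bmeas_power2)
    also have "\<dots> \<le> real k / real n + 1 / real n"
      using Suc.IH k incr_second_moment[OF k] ort by simp
    finally show ?case by (simp add: add_divide_distrib add.commute)
  qed
  from this[of n] show ?thesis using n_pos by simp
qed

text \<open>The conditional variance of the centred increment \<open>incr k\<close> given the
  coordinates 1, ..., k; the sum over k < n is V.\<close>

definition cvar :: "nat \<Rightarrow> (nat \<Rightarrow> 'a) \<Rightarrow> real" where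
  "cvar k = avg (Suc k) (\<lambda>w. (incr k w)\<^sup>2)"

lemma cvar_bmeas [intro, simp]: "k < n \<Longrightarrow> bmeas (cvar k)"
  unfolding cvar_def by (intro bmeas_avg bmeas_power2) simp

lemma cvar_depends: "k < n \<Longrightarrow> depends {1..k} (cvar k)"
  unfolding cvar_def
proof (rule depends_avg_Suc)
  assume k: "k < n"
  then show "depends {1..Suc k} (\<lambda>w. (incr k w)\<^sup>2)"
    using depends_mono[OF proj_depends[of k], of "{1..Suc k}"] proj_depends[of "Suc k"]
    unfolding incr_def[abs_def] depends_def by (auto, metis)
qed

text \<open>After \<open>exp_le_quadratic\<close> the linear term averages to 0, and 1 + y \<le> exp
  y turns the quadratic one into exactly the compensator. The bound on \<theta> keeps \<theta> times
  the increment within 37/100.\<close>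

lemma exp_supermartingale:
  assumes "k \<le> n" and \<theta>: "\<bar>\<theta>\<bar> \<le> 74 / 100"
  shows "(\<integral>w. exp (\<theta> * (proj k w - mean) - 3 / 5 * \<theta>\<^sup>2 * (\<Sum>j<k. cvar j w)) \<partial>P) \<le> 1"
  using assms(1)
proof (induction k)
  case 0
  then show ?case using P.prob_space by (simp add: proj_0)
next
  case (Suc k)
  then have k: "k < n" by simp
  let ?c = "3 / 5 * \<theta>\<^sup>2"
  define G where "G = (\<lambda>w. exp (\<theta> * (proj k w - mean) - ?c * (\<Sum>j<k. cvar j w)))"
  have bG: "bmeas G" unfolding G_def using k
    by (intro bmeas_exp bmeas_diff bmeas_mult bmeas_sum bmeas_const) auto
  have be: "bmeas (\<lambda>w. exp (\<theta> * incr k w))" by (intro bmeas_intros incr_bmeas k)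
  have bc: "bmeas (\<lambda>w. exp (- (?c * cvar k w)))"
    using k by (intro bmeas_exp bmeas_uminus bmeas_mult bmeas_const) auto
  have dep: "depends {1..k} (\<lambda>w. G w * exp (- (?c * cvar k w)))"
    unfolding depends_def
  proof (intro allI impI)
    fix w w' :: "nat \<Rightarrow> 'a" assume eq: "\<forall>i\<in>{1..k}. w i = w' i"
    have "proj k w = proj k w'" using eq k by (intro dependsD[OF proj_depends[of k]]) auto
    moreover have "cvar j w = cvar j w'" if "j \<le> k" for j
      using eq k that by (intro dependsD[OF cvar_depends[of j]]) auto
    ultimately show "G w * exp (- (?c * cvar k w)) = G w' * exp (- (?c * cvar k w'))"
      by (simp add: G_def)
  qed
  have eq: "exp (\<theta> * (proj (Suc k) w - mean) - ?c * (\<Sum>j<Suc k. cvar j w))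
      = G w * exp (- (?c * cvar k w)) * exp (\<theta> * incr k w)" for w
    by (simp add: G_def incr_def mult_exp_exp algebra_simps)
  have key: "avg (Suc k) (\<lambda>w. exp (\<theta> * incr k w)) w \<le> exp (?c * cvar k w)" for w
  proof -
    have "avg (Suc k) (\<lambda>w. exp (\<theta> * incr k w)) w
        \<le> avg (Suc k) (\<lambda>w. 1 + \<theta> * incr k w + 3 / 5 * (\<theta> * incr k w)\<^sup>2) w"
    proof (rule avg_mono[OF be])
      show "bmeas (\<lambda>w. 1 + \<theta> * incr k w + 3 / 5 * (\<theta> * incr k w)\<^sup>2)"
        using k by (intro bmeas_add bmeas_mult bmeas_power2 bmeas_const) auto
      fix w
      have "\<bar>\<theta> * incr k w\<bar> \<le> 74 / 100 * (1 / 2)"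
        unfolding abs_mult using \<theta> incr_abs_le[OF k] by (intro mult_mono) auto
      then show "exp (\<theta> * incr k w) \<le> 1 + \<theta> * incr k w + 3 / 5 * (\<theta> * incr k w)\<^sup>2"
        by (intro exp_le_quadratic) simp
    qed
    also have "\<dots> = 1 + \<theta> * avg (Suc k) (incr k) w + ?c * cvar k w"
      using k bmeas_upd_integrable[of "incr k"] bmeas_upd_integrable[of "\<lambda>w. (incr k w)\<^sup>2"]
      by (simp add: avg_def cvar_def power_mult_distrib bmeas_power2 mult_ac)
    also have "\<dots> \<le> exp (?c * cvar k w)"
      using k exp_ge_add_one_self[of "?c * cvar k w"] by (simp add: avg_incr)
    finally show ?thesis .
  qed
  have "(\<integral>w. exp (\<theta> * (proj (Suc k) w - mean) - ?c * (\<Sum>j<Suc k. cvar j w)) \<partial>P)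
      = (\<integral>w. avg (Suc k) (\<lambda>w. G w * exp (- (?c * cvar k w)) * exp (\<theta> * incr k w)) w \<partial>P)"
    unfolding eq using bG bc be by (intro integral_avg[symmetric] bmeas_mult)
  also have "\<dots> = (\<integral>w. G w * exp (- (?c * cvar k w)) * avg (Suc k) (\<lambda>w. exp (\<theta> * incr k w)) w \<partial>P)"
    by (subst avg_mult_left[OF dep]) auto
  also have "\<dots> \<le> (\<integral>w. G w \<partial>P)"
  proof (rule integral_mono)
    show "integrable P (\<lambda>w. G w * exp (- (?c * cvar k w)) * avg (Suc k) (\<lambda>w. exp (\<theta> * incr k w)) w)"
      using bG bc be by (intro bmeas_integrable bmeas_mult bmeas_avg)
    show "integrable P G" using bG by (rule bmeas_integrable)
    fix w
    have "G w * exp (- (?c * cvar k w)) * avg (Suc k) (\<lambda>w. exp (\<theta> * incr k w)) w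
        \<le> G w * exp (- (?c * cvar k w)) * exp (?c * cvar k w)"
      using key by (intro mult_left_mono) (auto simp: G_def)
    then show "G w * exp (- (?c * cvar k w)) * avg (Suc k) (\<lambda>w. exp (\<theta> * incr k w)) w \<le> G w"
      by (simp add: mult.assoc mult_exp_exp)
  qed
  also have "\<dots> \<le> 1" using Suc k by (simp add: G_def)
  finally show ?case .
qed

text \<open>The conditional variances are dependent, and convexity takes the place of independence.
  V is the uniform average over k of n \<open>cvar k\<close>, and \<open>cvar k\<close> is an
  average of the squared increment, so two applications of Jensen's inequality lead back to
  \<open>incr_exp_square\<close> with the same \<open>a\<close>.\<close>

lemma exp_cvar_sum:
  assumes a: "0 \<le> a" "2 * a < 1"
  shows "(\<integral>w. exp (a * (\<Sum>k<n. cvar k w)) \<partial>P) \<le> 1 / sqrt (1 - 2 * a)"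
proof -
  define c where "c = real n * a"
  have c: "0 \<le> c" using a by (simp add: c_def)
  have jensen: "exp (a * (\<Sum>k<n. cvar k w)) \<le> (\<Sum>k<n. (1 / real n) * exp (c * cvar k w))" for w
  proof -
    have "exp (\<Sum>k<n. (1 / real n) *\<^sub>R (c * cvar k w)) \<le> (\<Sum>k<n. (1 / real n) * exp (c * cvar k w))"
      using n_pos by (intro convex_on_sum[OF _ _ exp_convex]) auto
    moreover have "(\<Sum>k<n. (1 / real n) *\<^sub>R (c * cvar k w)) = a * (\<Sum>k<n. cvar k w)"
      using n_pos by (simp add: c_def sum_distrib_left)
    ultimately show ?thesis by simp
  qed
  have jensen': "exp (c * cvar k w) \<le> avg (Suc k) (\<lambda>w. exp (c * (incr k w)\<^sup>2)) w" if k: "k < n" for k w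
  proof -
    have "exp (\<integral>x. c * (incr k (w(Suc k := x)))\<^sup>2 \<partial>\<mu>) \<le> (\<integral>x. exp (c * (incr k (w(Suc k := x)))\<^sup>2) \<partial>\<mu>)"
      using k bmeas_upd_integrable[of "\<lambda>w. (incr k w)\<^sup>2"]
      by (intro jensens_inequality[where I = UNIV] exp_convex
            bmeas_upd_integrable[of "\<lambda>w. exp (c * (incr k w)\<^sup>2)"]) (auto intro!: bmeas_exp bmeas_mult)
    then show ?thesis by (simp add: cvar_def avg_def)
  qed
  have be: "bmeas (\<lambda>w. exp (c * cvar k w))" "bmeas (\<lambda>w. exp (c * (incr k w)\<^sup>2))" if "k < n" for k
    using that by (auto intro!: bmeas_exp bmeas_mult)
  have "(\<integral>w. exp (a * (\<Sum>k<n. cvar k w)) \<partial>P) \<le> (\<integral>w. (\<Sum>k<n. (1 / real n) * exp (c * cvar k w)) \<partial>P)"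
    using jensen be by (intro integral_mono bmeas_integrable bmeas_exp bmeas_mult bmeas_sum) auto
  also have "\<dots> = (\<Sum>k<n. (1 / real n) * (\<integral>w. exp (c * cvar k w) \<partial>P))"
    using be by (subst Bochner_Integration.integral_sum)
      (auto simp del: times_divide_eq_left intro!: bmeas_integrable)
  also have "\<dots> \<le> (\<Sum>k<n. (1 / real n) * (1 / sqrt (1 - 2 * a)))"
  proof (intro sum_mono mult_left_mono)
    fix k assume "k \<in> {..<n}"
    then have k: "k < n" by simp
    have "(\<integral>w. exp (c * cvar k w) \<partial>P) \<le> integral\<^sup>L P (avg (Suc k) (\<lambda>w. exp (c * (incr k w)\<^sup>2)))"
      using jensen'[OF k] be[OF k] by (intro integral_mono bmeas_integrable) auto
    also have "\<dots> = (\<integral>w. exp (c * (incr k w)\<^sup>2) \<partial>P)" by (rule integral_avg) (rule be(2)[OF k])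
    also have "\<dots> \<le> 1 / sqrt (1 - 2 * a)" unfolding c_def by (rule incr_exp_square[OF k a])
    finally show "(\<integral>w. exp (c * cvar k w) \<partial>P) \<le> 1 / sqrt (1 - 2 * a)" .
  qed auto
  also have "\<dots> = 1 / sqrt (1 - 2 * a)" using n_pos by simp
  finally show ?thesis .
qed

lemma mgf_bound:
  assumes l: "\<bar>l\<bar> = 1 / exp 1"
  shows "(\<integral>w. exp (l * (F w - mean)) \<partial>P) \<le> 131 / 100"
proof -
  \<comment> \<open>The compensator belongs to \<theta> = 2 l: exp (l (F - E F)) is split below as
    the product of the square roots of \<open>f\<close> and \<open>g\<close>.\<close>
  define a where "a = 3 / 5 * (2 * l)\<^sup>2"
  define V where "V w = (\<Sum>k<n. cvar k w)" for w
  have l_le: "\<bar>l\<bar> \<le> 1000 / 2709"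
    unfolding l using exp_1_lower by (simp add: field_simps)
  then have l2: "l\<^sup>2 \<le> (1000 / 2709)\<^sup>2" using power_mono[of "\<bar>l\<bar>" "1000 / 2709" 2] by simp
  then have a: "0 \<le> a" "a \<le> 328 / 1000" by (auto simp: a_def power_mult_distrib power2_eq_square)
  \<comment> \<open>Numerically 1 - 2 (0.328) = 0.344, which exceeds (100/171)^2.\<close>
  have "100 / 171 \<le> sqrt (1 - 2 * a)" using a by (intro real_le_rsqrt) (simp add: power2_eq_square)
  then have R: "1 / sqrt (1 - 2 * a) \<le> 171 / 100"
    using a by (simp add: field_simps)
  have bV: "bmeas V" unfolding V_def[abs_def] by (intro bmeas_sum) simp
  define f where "f w = exp (2 * l * (F w - mean) - a * V w)" for w
  define g where "g w = exp (a * V w)" for w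
  have bf: "bmeas f" "bmeas g" unfolding f_def[abs_def] g_def[abs_def] using bV F_bmeas
    by (auto intro!: bmeas_exp bmeas_diff bmeas_mult)
  have "exp (l * (F w - mean)) \<le> 65 / 100 * f w + 100 / 260 * g w" for w
  proof -
    let ?u = "exp (l * (F w - mean) - a * V w / 2)" and ?v = "exp (a * V w / 2)"
    \<comment> \<open>A weighted arithmetic-geometric mean inequality does the work of
      Cauchy-Schwarz. The weight 13/10 is close to sqrt 1.71, the best choice when the integrals of
      \<open>f\<close> and \<open>g\<close> are bounded by 1 and 1.71.\<close>
    have "2 * (13 / 10) * (u * v) \<le> (13 / 10)\<^sup>2 * u\<^sup>2 + v\<^sup>2" for u v :: real
      using zero_le_power2[of "13 / 10 * u - v"] by (simp add: power2_eq_square algebra_simps)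
    note this[of ?u ?v]
    moreover have "?u * ?v = exp (l * (F w - mean))" "?u\<^sup>2 = f w" "?v\<^sup>2 = g w"
      by (simp_all add: f_def g_def mult_exp_exp power2_eq_square algebra_simps)
    ultimately show ?thesis by (simp add: power2_eq_square)
  qed
  then have "(\<integral>w. exp (l * (F w - mean)) \<partial>P) \<le> (\<integral>w. 65 / 100 * f w + 100 / 260 * g w \<partial>P)"
    using bf F_bmeas
    by (intro integral_mono bmeas_integrable bmeas_exp bmeas_add bmeas_mult bmeas_diff bmeas_const) auto
  also have "\<dots> = 65 / 100 * integral\<^sup>L P f + 100 / 260 * integral\<^sup>L P g"
    using bf by (simp add: bmeas_integrable)
  also have "\<dots> \<le> 65 / 100 * 1 + 100 / 260 * (171 / 100)"
  proof (intro add_mono mult_left_mono)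
    show "integral\<^sup>L P f \<le> 1"
      using exp_supermartingale[of n "2 * l"] l_le unfolding f_def[abs_def] a_def V_def by simp
    show "integral\<^sup>L P g \<le> 171 / 100"
      using exp_cvar_sum[of a] a R unfolding g_def[abs_def] V_def by simp
  qed auto
  also have "\<dots> \<le> 131 / 100" by simp
  finally show ?thesis .
qed

end

section \<open>Numerical side of the tail bound\<close>

lemma ln_2_lower: "68 / 100 \<le> ln (2 :: real)"
proof -
  \<comment> \<open>The fraction is 68/100 = 17/25, and 2.72^17 < 2^25.\<close>
  have "exp (68 / 100 :: real) ^ 25 = exp 1 ^ 17"
    by (simp flip: exp_of_nat_mult)
  also have "\<dots> \<le> (272 / 100) ^ 17" using e_less_272 by (intro power_mono) auto
  also have "\<dots> \<le> 2 ^ 25" by (simp add: power_divide)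
  finally have "exp (68 / 100 :: real) \<le> 2" by (rule power_le_imp_le_base[where n = 24, simplified]) simp
  then show ?thesis using ln_ge_iff[of "2 :: real" "68 / 100"] by simp
qed

lemma ln_8: "ln (8 :: real) = 3 * ln 2"
  using ln_realpow[of 2 3] by simp

text \<open>As x - ln (1 + x) is increasing, the worst case is x = 7, where ln 8 = 3 ln 2. What
  remains is 7 - 3 ln 2 \<le> e^2 ln 2; with the bounds at hand this reads 4.96 against 0.68
  (2.709)^2 > 4.99.\<close>

lemma tail_bound_trivial:
  fixes x :: real
  assumes "0 \<le> x" "x \<le> 7"
  shows "1 \<le> 2 * exp ((ln (1 + x) - x) / (exp 1)\<^sup>2)"
proof -
  have "ln 8 - 7 \<le> ln (1 + x) - x"
  proof -
    have "ln 8 - ln (1 + x) = ln (8 / (1 + x))" using assms by (simp add: ln_div)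
    also have "\<dots> \<le> 8 / (1 + x) - 1" using assms by (intro ln_le_minus_one) simp
    also have "\<dots> = (7 - x) / (1 + x)" using assms by (simp add: field_simps)
    also have "\<dots> \<le> 7 - x" using assms using mult_left_mono[of 1 "1 + x" "7 - x"] by (simp add: divide_le_eq)
    finally show ?thesis by simp
  qed
  moreover have "- ln 2 * (exp 1)\<^sup>2 \<le> ln 8 - (7 :: real)"
  proof -
    have "(2709 / 1000)\<^sup>2 \<le> (exp 1 :: real)\<^sup>2" using exp_1_lower by (rule power_mono) simp
    then have "68 / 100 * (2709 / 1000)\<^sup>2 \<le> ln 2 * (exp 1 :: real)\<^sup>2"
      using ln_2_lower by (intro mult_mono) auto
    then show ?thesis using ln_2_lower unfolding ln_8 by (simp add: power2_eq_square)
  qed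
  ultimately have "- ln 2 \<le> (ln (1 + x) - x) / (exp 1)\<^sup>2"
    by (simp add: pos_le_divide_eq)
  then have "exp (- ln 2) \<le> exp ((ln (1 + x) - x) / (exp 1)\<^sup>2)" by simp
  then show ?thesis by (simp add: exp_minus)
qed

text \<open>Here the logarithm in the target pays for the constant of \<open>mgf_bound\<close>: ln 8
  / e^2 is at least 2.04 / 7.4 > 0.275, and exp 0.275 > 1.31.\<close>

lemma tail_bound_prefactor:
  fixes x :: real
  assumes "7 \<le> x"
  shows "131 / 100 \<le> exp (ln (1 + x) / (exp 1)\<^sup>2)"
proof -
  have "(exp 1)\<^sup>2 \<le> (272 / 100 :: real)\<^sup>2" using e_less_272 by (intro power_mono) auto
  then have "(exp 1)\<^sup>2 \<le> (74 / 10 :: real)" by (simp add: power2_eq_square)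
  moreover have "ln 8 \<le> ln (1 + x)" using assms by simp
  then have "204 / 100 \<le> ln (1 + x)" using ln_2_lower unfolding ln_8 by simp
  ultimately have "(204 / 100) / (74 / 10) \<le> ln (1 + x) / (exp 1)\<^sup>2"
    by (intro frac_le) auto
  then have "275 / 1000 \<le> ln (1 + x) / (exp 1)\<^sup>2" by simp
  then have "exp (275 / 1000) \<le> exp (ln (1 + x) / (exp 1)\<^sup>2)" by simp
  moreover have "1 + 275 / 1000 + (275 / 1000)\<^sup>2 / 2 \<le> exp (275 / 1000 :: real)"
    by (rule exp_lower_Taylor_quadratic) simp
  then have "131 / 100 \<le> exp (275 / 1000 :: real)" by (simp add: power2_eq_square)
  ultimately show ?thesis by linarith
qed

context degenerate_statistic
begin

lemma F_measurable [measurable]: "F \<in> borel_measurable P"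
  using F_bmeas by (rule bmeasD)

lemma one_sided_tail:
  assumes l: "\<bar>l\<bar> = 1 / exp 1"
  shows "P.prob {w. l * (F w - mean) \<ge> y} \<le> 131 / 100 * exp (- y)"
proof -
  have "P.prob {w. l * (F w - mean) \<ge> y} = P.prob {w \<in> space P. exp y \<le> exp (l * (F w - mean))}"
    by simp
  also have "\<dots> \<le> (\<integral>w. exp (l * (F w - mean)) \<partial>P) / exp y"
    by (rule integral_Markov_inequality_measure[where A = "{}"])
       (auto intro!: bmeas_integrable bmeas_intros F_bmeas)
  also have "\<dots> \<le> (131 / 100) / exp y" by (intro divide_right_mono mgf_bound l) simp
  finally show ?thesis by (simp add: exp_minus field_simps)
qed

lemma tail_bound:
  assumes x: "0 \<le> x"
  shows "P.prob {w. \<bar>F w - mean\<bar> \<ge> x / exp 1} \<le> 2 * exp ((ln (1 + x) - x) / (exp 1)\<^sup>2)"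
proof (cases "x \<le> 7")
  case True
  then show ?thesis using tail_bound_trivial[OF x] P.prob_le_1 order_trans by blast
next
  case False
  let ?e = "exp 1 :: real"
  \<comment> \<open>Multiplying by 1/e, the parameter of the known exponential moment, turns the
    threshold x/e into x/e^2.\<close>
  have eq: "x / ?e \<le> \<bar>z\<bar> \<longleftrightarrow> x / ?e\<^sup>2 \<le> 1 / ?e * z \<or> x / ?e\<^sup>2 \<le> - 1 / ?e * z" for z
  proof -
    have "x / ?e \<le> \<bar>z\<bar> \<longleftrightarrow> x / ?e\<^sup>2 \<le> \<bar>1 / ?e * z\<bar>"
      by (simp add: abs_mult power2_eq_square field_simps)
    then show ?thesis by (simp add: abs_if) linarith
  qed
  have "P.prob {w. \<bar>F w - mean\<bar> \<ge> x / ?e}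
      = P.prob ({w. 1 / ?e * (F w - mean) \<ge> x / ?e\<^sup>2} \<union> {w. - 1 / ?e * (F w - mean) \<ge> x / ?e\<^sup>2})"
    unfolding eq by (rule arg_cong[where f = P.prob]) auto
  also have "\<dots> \<le> P.prob {w. 1 / ?e * (F w - mean) \<ge> x / ?e\<^sup>2} + P.prob {w. - 1 / ?e * (F w - mean) \<ge> x / ?e\<^sup>2}"
  proof (rule measure_subadditive)
    have meas: "{w. l * (F w - mean) \<ge> y} \<in> sets P" for l y
    proof -
      have "{w \<in> space P. l * (F w - mean) \<ge> y} \<in> sets P" by measurable
      then show ?thesis by simp
    qed
    show "{w. 1 / ?e * (F w - mean) \<ge> x / ?e\<^sup>2} \<in> sets P" "{w. - 1 / ?e * (F w - mean) \<ge> x / ?e\<^sup>2} \<in> sets P"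
      by (rule meas)+
  qed simp_all
  also have "\<dots> \<le> 131 / 100 * exp (- (x / ?e\<^sup>2)) + 131 / 100 * exp (- (x / ?e\<^sup>2))"
    by (intro add_mono one_sided_tail) auto
  also have "\<dots> = 2 * (131 / 100) * exp (- (x / ?e\<^sup>2))" by simp
  also have "\<dots> \<le> 2 * exp (ln (1 + x) / ?e\<^sup>2) * exp (- (x / ?e\<^sup>2))"
    using False by (intro mult_right_mono mult_left_mono tail_bound_prefactor) auto
  also have "\<dots> = 2 * exp ((ln (1 + x) - x) / ?e\<^sup>2)"
    by (simp add: mult_exp_exp diff_divide_distrib)
  finally show ?thesis .
qed

end

section \<open>Compact homogeneous spaces\<close>

definition measure_isometry :: "'a::metric_space measure \<Rightarrow> ('a \<Rightarrow> 'a) \<Rightarrow> bool" where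
  "measure_isometry \<mu> g \<longleftrightarrow> (\<forall>x y. dist (g x) (g y) = dist x y) \<and> g \<in> \<mu> \<rightarrow>\<^sub>M \<mu> \<and> distr \<mu> \<mu> g = \<mu>"

lemma measurable_borel_of_topology:
  assumes "continuous_map S T f"
  shows "f \<in> borel_of_topology S \<rightarrow>\<^sub>M borel_of_topology T"
proof -
  have T: "{U. openin T U} \<subseteq> Pow (topspace T)" and S: "{U. openin S U} \<subseteq> Pow (topspace S)"
    by (auto dest: openin_subset)
  show ?thesis
    unfolding borel_of_topology_def
  proof (rule measurable_sigma_sets)
    show "sets (sigma (topspace T) {U. openin T U}) = sigma_sets (topspace T) {U. openin T U}"
      by (rule sets_measure_of[OF T])
    show "f \<in> space (sigma (topspace S) {U. openin S U}) \<rightarrow> topspace T"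
      using assms S by (auto simp: continuous_map_def)
    fix U assume "U \<in> {U. openin T U}"
    then have "openin S {x \<in> topspace S. f x \<in> U}"
      using assms by (simp add: continuous_map_def)
    moreover have "f -` U \<inter> space (sigma (topspace S) {U. openin S U}) = {x \<in> topspace S. f x \<in> U}"
      using S by auto
    ultimately show "f -` U \<inter> space (sigma (topspace S) {U. openin S U}) \<in> sets (sigma (topspace S) {U. openin S U})"
      using S by (auto intro!: sigma_sets.Basic)
  qed (rule T)
qed

lemma borel_of_topology_euclidean: "borel_of_topology euclidean = borel"
  by (simp add: borel_of_topology_def borel_def)

lemma space_borel_of_topology [simp]: "space (borel_of_topology T) = topspace T"
  unfolding borel_of_topology_def by (rule space_measure_of) (auto dest: openin_subset)

lemma (in Metric_space) continuous_map_isometryI: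
  assumes "Metric_space N E" and "\<And>x. x \<in> M \<Longrightarrow> f x \<in> N"
    and "\<And>x y. x \<in> M \<Longrightarrow> y \<in> M \<Longrightarrow> E (f x) (f y) = d x y"
  shows "continuous_map mtopology (Metric_space.mtopology N E) f"
proof -
  show ?thesis
    unfolding metric_continuous_map[OF assms(1)] using assms(2,3) by (auto simp: image_subset_iff)
qed

text \<open>If the points correspond to the cosets aK and bK, left translation by c = b a^(-1)
  carries the first to the second. It preserves the distance by invariance, and the law because it
  lifts to multiplication by c on the group, which fixes the Haar measure. Its conjugate under
  \<open>f\<close> is the required map; all maps between the metric spaces are isometries, hence
  continuous and Borel measurable.\<close>

lemma compact_homogeneous_transitive:
  fixes G :: "('g, 'z) monoid_scheme" and \<mu> :: "'a::polish_space measure"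
  assumes hom: "compact_homogeneous_space G T \<mu>"
  shows "\<exists>g. measure_isometry \<mu> g \<and> g x = y"
proof -
  from hom obtain K D h f where
    sets: "sets \<mu> = sets borel" and cg: "compact_group G T" and
    K: "subgroup K G" and
    inv: "invariant_quotient_distance G T K D" and haar: "haar_probability G T h" and
    bij: "bij_betw f (UNIV :: 'a set) (lcosets\<^bsub>G\<^esub> K)" and
    iso: "\<And>x y. D (f x) (f y) = dist x y" and
    law: "distr \<mu> (borel_of_topology (Metric_space.mtopology (lcosets\<^bsub>G\<^esub> K) D)) f = quotient_haar G K D h"
    unfolding compact_homogeneous_space_def mm_space_def by blast
  interpret group G using cg by (simp add: compact_group_def)
  let ?Q = "lcosets\<^bsub>G\<^esub> K"
  interpret Q: Metric_space ?Q D using inv by (simp add: invariant_quotient_distance_def)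
  let ?B = "borel_of_topology Q.mtopology"
  define \<pi> where "\<pi> = (\<lambda>a. a <#\<^bsub>G\<^esub> K)"
  have topG: "topspace T = carrier G" and
    mulcont: "continuous_map (prod_topology T T) T (\<lambda>(x, y). x \<otimes>\<^bsub>G\<^esub> y)"
    using cg by (auto simp: compact_group_def)
  have sets_h: "sets h = sets (borel_of_topology T)" and space_h: "space h = carrier G" and
    h_inv: "\<And>a. a \<in> carrier G \<Longrightarrow> distr h h (\<lambda>x. a \<otimes>\<^bsub>G\<^esub> x) = h"
    using haar topG by (auto simp: haar_probability_def)
  have fQ: "f z \<in> ?Q" for z using bij by (auto simp: bij_betw_def)
  obtain a b where a: "a \<in> carrier G" "f x = \<pi> a" and b: "b \<in> carrier G" "f y = \<pi> b"
    using fQ[of x] fQ[of y] by (auto simp: LCOSETS_def \<pi>_def)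
  define c where "c = b \<otimes>\<^bsub>G\<^esub> inv\<^bsub>G\<^esub> a"
  have c: "c \<in> carrier G" using a b by (simp add: c_def)
  define L where "L = (\<lambda>R. c <#\<^bsub>G\<^esub> R)"
  have L_\<pi>: "L (\<pi> z) = \<pi> (c \<otimes>\<^bsub>G\<^esub> z)" if "z \<in> carrier G" for z
    unfolding L_def \<pi>_def using c that subgroup.subset[OF K] by (rule lcos_m_assoc[OF _ _ , rotated])
  have LQ: "L R \<in> ?Q" if "R \<in> ?Q" for R
    using that L_\<pi> c by (auto simp: LCOSETS_def \<pi>_def)
  have L_iso: "D (L R) (L R') = D R R'" if "R \<in> ?Q" "R' \<in> ?Q" for R R'
    using that c inv by (simp add: invariant_quotient_distance_def L_def)
  have "c \<otimes>\<^bsub>G\<^esub> a = b" using a b by (simp add: c_def m_assoc)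
  then have L_fx: "L (f x) = f y" using a b L_\<pi> by simp
  define k where "k = inv_into UNIV f"
  have fk: "f (k R) = R" if "R \<in> ?Q" for R
    using f_inv_into_f[of R f UNIV] that bij by (simp add: k_def bij_betw_def)
  have kf: "k (f z) = z" for z using bij by (simp add: k_def bij_betw_def)
  have k_iso: "dist (k R) (k R') = D R R'" if "R \<in> ?Q" "R' \<in> ?Q" for R R'
    using that iso[of "k R" "k R'"] by (simp add: fk)
  have f_meas: "f \<in> \<mu> \<rightarrow>\<^sub>M ?B"
  proof -
    have "continuous_map Met_TC.mtopology Q.mtopology f"
      by (rule Met_TC.continuous_map_isometryI) (use fQ iso Q.Metric_space_axioms in auto)
    then show ?thesis
      using measurable_borel_of_topology[of euclidean Q.mtopology f] sets
      by (simp add: borel_of_topology_euclidean cong: measurable_cong_sets)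
  qed
  have k_meas: "k \<in> ?B \<rightarrow>\<^sub>M \<mu>"
  proof -
    have "continuous_map Q.mtopology Met_TC.mtopology k"
      by (rule Q.continuous_map_isometryI) (use k_iso Met_TC.Metric_space_axioms in auto)
    then show ?thesis
      using measurable_borel_of_topology[of Q.mtopology euclidean k] sets
      by (simp add: borel_of_topology_euclidean cong: measurable_cong_sets)
  qed
  have L_meas: "L \<in> ?B \<rightarrow>\<^sub>M ?B"
    by (intro measurable_borel_of_topology Q.continuous_map_isometryI)
      (use LQ L_iso Q.Metric_space_axioms in auto)
  have \<pi>_meas: "\<pi> \<in> h \<rightarrow>\<^sub>M ?B"
  proof -
    have "quotient_map T Q.mtopology \<pi>" using inv by (simp add: invariant_quotient_distance_def \<pi>_def)
    then have "\<pi> \<in> borel_of_topology T \<rightarrow>\<^sub>M ?B"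
      by (intro measurable_borel_of_topology quotient_imp_continuous_map)
    then show ?thesis using sets_h by (simp cong: measurable_cong_sets)
  qed
  have c_meas: "(\<lambda>z. c \<otimes>\<^bsub>G\<^esub> z) \<in> h \<rightarrow>\<^sub>M h"
  proof -
    have "continuous_map T (prod_topology T T) (\<lambda>z. (c, z))"
      using c topG by (intro continuous_map_pairedI) auto
    then have "continuous_map T T ((\<lambda>(x, y). x \<otimes>\<^bsub>G\<^esub> y) \<circ> (\<lambda>z. (c, z)))"
      using mulcont by (rule continuous_map_compose)
    then have "(\<lambda>z. c \<otimes>\<^bsub>G\<^esub> z) \<in> borel_of_topology T \<rightarrow>\<^sub>M borel_of_topology T"
      by (intro measurable_borel_of_topology) (simp add: comp_def)
    then show ?thesis using sets_h by (simp cong: measurable_cong_sets)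
  qed
  have law': "distr \<mu> ?B f = distr h ?B \<pi>" using law by (simp add: quotient_haar_def \<pi>_def)
  have "distr (distr h ?B \<pi>) ?B L = distr h ?B (L \<circ> \<pi>)"
    by (rule distr_distr) (fact L_meas \<pi>_meas)+
  also have "\<dots> = distr h ?B (\<pi> \<circ> (\<lambda>z. c \<otimes>\<^bsub>G\<^esub> z))"
    by (rule distr_cong) (auto simp: space_h L_\<pi>)
  also have "\<dots> = distr (distr h h (\<lambda>z. c \<otimes>\<^bsub>G\<^esub> z)) ?B \<pi>"
    by (rule distr_distr[symmetric]) (fact \<pi>_meas c_meas)+
  also have "\<dots> = distr h ?B \<pi>" using h_inv[OF c] by simp
  finally have L_inv: "distr (distr \<mu> ?B f) ?B L = distr \<mu> ?B f" by (simp add: law')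
  define g where "g = k \<circ> L \<circ> f"
  have g_meas: "g \<in> \<mu> \<rightarrow>\<^sub>M \<mu>"
    unfolding g_def using f_meas L_meas k_meas by (intro measurable_comp)
  have "distr \<mu> \<mu> g = distr (distr (distr \<mu> ?B f) ?B L) \<mu> k"
    unfolding g_def using f_meas L_meas k_meas
    by (subst distr_distr) (auto simp: distr_distr comp_assoc intro!: measurable_comp)
  also have "\<dots> = distr \<mu> \<mu> (k \<circ> f)" unfolding L_inv using f_meas k_meas by (rule distr_distr[rotated])
  also have "\<dots> = \<mu>" by (simp add: comp_def kf)
  finally have "distr \<mu> \<mu> g = \<mu>" .
  moreover have "dist (g u) (g v) = dist u v" for u v
    unfolding g_def by (simp add: k_iso LQ fQ L_iso iso)
  moreover have "g x = y" by (simp add: g_def L_fx kf)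
  ultimately show ?thesis using g_meas by (auto simp: measure_isometry_def)
qed

context iid_product
begin

text \<open>Cylinders over finitely many coordinates determine the product measure.\<close>

lemma P_map_component:
  assumes g: "g \<in> \<mu> \<rightarrow>\<^sub>M \<mu>" "distr \<mu> \<mu> g = \<mu>"
  shows "(\<lambda>w i. g (w i)) \<in> P \<rightarrow>\<^sub>M P" "distr P P (\<lambda>w i. g (w i)) = P"
proof -
  interpret PP: product_prob_space "\<lambda>_ :: nat. \<mu>" UNIV by unfold_locales
  show meas: "(\<lambda>w i. g (w i)) \<in> P \<rightarrow>\<^sub>M P"
    unfolding P_def using g(1) by (intro measurable_PiM_single') auto
  have "distr P P (\<lambda>w i. g (w i)) = PiM UNIV (\<lambda>_. \<mu>)"
  proof (rule PP.PiM_eq)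
    fix J :: "nat set" and F assume J: "finite J" and F: "\<And>j. j \<in> J \<Longrightarrow> F j \<in> sets \<mu>"
    let ?emb = "prod_emb UNIV (\<lambda>_. \<mu>) J"
    have "emeasure (distr P P (\<lambda>w i. g (w i))) (?emb (Pi\<^sub>E J F))
        = emeasure P ((\<lambda>w i. g (w i)) -` ?emb (Pi\<^sub>E J F) \<inter> space P)"
      using J F by (intro emeasure_distr meas) (auto simp: sets_P intro!: sets_PiM_I)
    also have "(\<lambda>w i. g (w i)) -` ?emb (Pi\<^sub>E J F) \<inter> space P = ?emb (\<Pi>\<^sub>E j\<in>J. g -` F j \<inter> space \<mu>)"
      by (auto simp: prod_emb_def space_PiM PiE_iff)
    also have "emeasure P \<dots> = (\<Prod>j\<in>J. emeasure \<mu> (g -` F j \<inter> space \<mu>))"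
      unfolding P_def using J F g(1)
      by (intro emeasure_PiM_emb prob_space_axioms measurable_sets) auto
    also have "\<dots> = (\<Prod>j\<in>J. emeasure (distr \<mu> \<mu> g) (F j))"
      using F g(1) by (intro prod.cong refl emeasure_distr[symmetric]) auto
    finally show "emeasure (distr P P (\<lambda>w i. g (w i))) (?emb (Pi\<^sub>E J F)) = (\<Prod>j\<in>J. emeasure \<mu> (F j))"
      unfolding g(2) .
  qed (simp add: sets_P)
  then show "distr P P (\<lambda>w i. g (w i)) = P" by (simp add: P_def)
qed

end

locale transitive_product = iid_product \<mu> for \<mu> :: "'a::polish_space measure" +
  assumes sets_mu: "sets \<mu> = sets borel"
    and transitive: "\<And>x y. \<exists>g. measure_isometry \<mu> g \<and> g x = y"
begin

lemma integral_conditioned: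
  assumes f: "bmeas f"
    and inv: "\<And>g w. measure_isometry \<mu> g \<Longrightarrow> f (\<lambda>i. g (w i)) = f w"
  shows "(\<integral>w. f (w(k := x)) \<partial>P) = integral\<^sup>L P f"
proof -
  have eq: "(\<integral>w. f (w(k := x)) \<partial>P) = (\<integral>w. f (w(k := y)) \<partial>P)" for x y
  proof -
    obtain g where g: "measure_isometry \<mu> g" and gx: "g x = y" using transitive by blast
    then have gm: "g \<in> \<mu> \<rightarrow>\<^sub>M \<mu>" "distr \<mu> \<mu> g = \<mu>" by (auto simp: measure_isometry_def)
    have "(\<integral>w. f (w(k := y)) \<partial>P) = (\<integral>w. f (w(k := y)) \<partial>distr P P (\<lambda>w i. g (w i)))"
      by (simp add: P_map_component(2)[OF gm])
    also have "\<dots> = (\<integral>w. f ((\<lambda>i. g (w i))(k := y)) \<partial>P)"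
      using f by (intro integral_distr P_map_component gm) (auto intro!: bmeasD bmeas_upd)
    also have "\<dots> = (\<integral>w. f (\<lambda>i. g ((w(k := x)) i)) \<partial>P)"
      by (intro Bochner_Integration.integral_cong refl arg_cong[where f = f]) (auto simp: gx)
    also have "\<dots> = (\<integral>w. f (w(k := x)) \<partial>P)" by (subst inv[OF g]) (rule refl)
    finally show ?thesis ..
  qed
  have "integral\<^sup>L P f = (\<integral>y. (\<integral>w. f (w(k := y)) \<partial>P) \<partial>\<mu>)" by (rule integral_split[OF f])
  also have "\<dots> = (\<integral>y. (\<integral>w. f (w(k := x)) \<partial>P) \<partial>\<mu>)"
    by (intro Bochner_Integration.integral_cong refl eq)
  finally show ?thesis by simp
qed

end

section \<open>The statistic of a homogeneous space\<close>

locale homogeneous_statistic = transitive_product \<mu> for \<mu> :: "'a::polish_space measure" +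
  fixes p :: nat and \<phi> :: "(nat \<times> nat \<Rightarrow> real) \<Rightarrow> real"
  assumes p_pos: "p \<ge> 1" and bounded_continuous: "bounded_continuous p \<phi>"
begin

abbreviation A :: real where "A \<equiv> sup_norm p \<phi>"

definition h :: "(nat \<Rightarrow> nat) \<Rightarrow> (nat \<Rightarrow> 'a) \<Rightarrow> real" where
  "h i w = \<phi> (\<lambda>(a, b)\<in>index_pairs p. dist (w (i a)) (w (i b)))"

definition tuples :: "nat \<Rightarrow> (nat \<Rightarrow> nat) set" where
  "tuples n = {1..p} \<rightarrow>\<^sub>E {1..n}"

abbreviation S :: "nat \<Rightarrow> (nat \<Rightarrow> 'a) \<Rightarrow> real" where
  "S \<equiv> S_stat p \<phi> (\<lambda>j w. w j)"

lemma S_eq: "S n w = (\<Sum>i\<in>tuples n. h i w)"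
  by (simp add: S_stat_def h_def tuples_def)

lemma finite_tuples [simp]: "finite (tuples n)"
  by (simp add: tuples_def finite_PiE)

lemma phi_abs_le: "v \<in> topspace (powertop_real (index_pairs p)) \<Longrightarrow> \<bar>\<phi> v\<bar> \<le> A"
  unfolding sup_norm_def
proof (rule cSUP_upper)
  have "bounded (\<phi> ` topspace (powertop_real (index_pairs p)))"
    using bounded_continuous by (simp add: bounded_continuous_def)
  then obtain B where "\<And>v. v \<in> topspace (powertop_real (index_pairs p)) \<Longrightarrow> \<bar>\<phi> v\<bar> \<le> B"
    by (auto simp: bounded_iff)
  then show "bdd_above ((\<lambda>v. \<bar>\<phi> v\<bar>) ` topspace (powertop_real (index_pairs p)))"
    by (intro bdd_aboveI[of _ B]) auto
qed

lemma h_abs_le: "\<bar>h i w\<bar> \<le> A"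
  unfolding h_def by (rule phi_abs_le) (auto simp: PiE_iff)

lemma h_bounds: "- A \<le> h i w" "h i w \<le> A"
  using h_abs_le[of i w] by linarith+

lemma A_nonneg: "0 \<le> A"
  using h_abs_le[of undefined undefined] by linarith

lemma measurable_coord: "(\<lambda>w. w j) \<in> P \<rightarrow>\<^sub>M borel"
proof -
  have "(\<lambda>w. w j) \<in> P \<rightarrow>\<^sub>M \<mu>" unfolding P_def by (rule measurable_component_singleton) simp
  then show ?thesis using sets_mu by (simp cong: measurable_cong_sets)
qed

lemma h_bmeas [simp]: "bmeas (h i)"
proof -
  let ?J = "index_pairs p"
  \<comment> \<open>Precomposition with the restriction extends \<phi> continuously to all functions
    on pairs of naturals. The index set is countable, so the Borel sets there form the product
    sigma-algebra. The zeros that \<open>D\<close> puts off the index set are removed by the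
    restriction.\<close>
  define \<phi>' where "\<phi>' = (\<lambda>v. \<phi> (restrict v ?J))"
  define D where "D = (\<lambda>w ab. if ab \<in> ?J then dist (w (i (fst ab))) (w (i (snd ab)) :: 'a) else 0)"
  have "continuous_map (powertop_real UNIV) (powertop_real ?J) (\<lambda>v. restrict v ?J)"
    by (auto simp: continuous_map_componentwise intro: continuous_map_product_projection)
  then have "continuous_map (powertop_real UNIV) euclideanreal (\<phi> \<circ> (\<lambda>v. restrict v ?J))"
    using bounded_continuous unfolding bounded_continuous_def by (intro continuous_map_compose) auto
  then have "continuous_on UNIV \<phi>'"
    by (simp add: \<phi>'_def comp_def euclidean_product_topology)
  then have "\<phi>' \<in> borel_measurable borel" by (rule borel_measurable_continuous_onI)
  then have \<phi>': "\<phi>' \<in> PiM UNIV (\<lambda>_. borel) \<rightarrow>\<^sub>M borel"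
    by (simp add: sets_PiM_equal_borel cong: measurable_cong_sets)
  have D: "D \<in> P \<rightarrow>\<^sub>M PiM UNIV (\<lambda>_. borel)"
  proof (rule measurable_PiM_single')
    fix ab :: "nat \<times> nat"
    note [measurable] = measurable_coord[of "i (fst ab)"] measurable_coord[of "i (snd ab)"]
    show "(\<lambda>w. D w ab) \<in> borel_measurable P" unfolding D_def by measurable
  qed auto
  have "h i = (\<lambda>w. \<phi>' (D w))"
    unfolding h_def \<phi>'_def D_def by (intro ext arg_cong[where f = \<phi>]) auto
  also have "\<dots> \<in> borel_measurable P" by (rule measurable_compose[OF D \<phi>'])
  finally show ?thesis using h_abs_le by (auto simp: bmeas_def)
qed

lemma h_depends: "depends (i ` {1..p}) (h i)"
  unfolding depends_def h_def
  by (intro allI impI arg_cong[where f = \<phi>]) (auto simp: index_pairs_def)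

lemma h_isometry: "measure_isometry \<mu> g \<Longrightarrow> h i (\<lambda>j. g (w j)) = h i w"
  by (simp add: h_def measure_isometry_def)

lemma h_conditioned: "(\<integral>w. h i (w(k := x)) \<partial>P) = integral\<^sup>L P (h i)"
  by (intro integral_conditioned h_isometry) auto

lemma S_bmeas [simp]: "bmeas (S n)"
  unfolding S_eq[abs_def] by (intro bmeas_sum) simp

lemma S_conditioned: "(\<integral>w. S n (w(k := x)) \<partial>P) = integral\<^sup>L P (S n)"
  by (intro integral_conditioned) (auto simp: S_eq h_isometry)

lemma tuples_range: "i \<in> tuples n \<Longrightarrow> i ` {1..p} \<subseteq> {1..n}"
  by (auto simp: tuples_def PiE_iff)

lemma S_depends: "depends {1..n} (S n)"
  unfolding depends_def
proof (intro allI impI)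
  fix w w' :: "nat \<Rightarrow> 'a" assume eq: "\<forall>i\<in>{1..n}. w i = w' i"
  show "S n w = S n w'"
    unfolding S_eq
  proof (rule sum.cong)
    fix i assume "i \<in> tuples n"
    then show "h i w = h i w'" using eq tuples_range by (intro dependsD[OF h_depends]) blast
  qed simp
qed

section \<open>Counting index tuples; oscillations of the statistic\<close>

lemma card_tuples_constrained:
  assumes C: "C \<subseteq> {1..p}"
  shows "card {i \<in> tuples n. \<forall>c\<in>C. i c = t c} \<le> n ^ (p - card C)"
proof -
  have fin: "finite C" using C by (rule finite_subset) simp
  have "{i \<in> tuples n. \<forall>c\<in>C. i c = t c} \<subseteq> PiE {1..p} (\<lambda>c. if c \<in> C then {t c} else {1..n})"
    using C by (auto simp: tuples_def PiE_def)
  then have "card {i \<in> tuples n. \<forall>c\<in>C. i c = t c} \<le> card (PiE {1..p} (\<lambda>c. if c \<in> C then {t c} else {1..n}))"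
    by (intro card_mono finite_PiE) auto
  also have "\<dots> = (\<Prod>c\<in>{1..p}. if c \<in> C then 1 else n)"
    by (subst card_PiE) (auto intro!: prod.cong)
  also have "\<dots> = n ^ card ({1..p} - C)"
    by (simp add: prod.If_cases Diff_eq)
  also have "card ({1..p} - C) = p - card C" using C fin by (simp add: card_Diff_subset)
  finally show ?thesis .
qed

lemma card_tuples_containing: "card {i \<in> tuples n. k \<in> i ` {1..p}} \<le> p * n ^ (p - 1)"
proof -
  have "{i \<in> tuples n. k \<in> i ` {1..p}} = (\<Union>a\<in>{1..p}. {i \<in> tuples n. \<forall>c\<in>{a}. i c = k})" by auto
  also have "card \<dots> \<le> (\<Sum>a\<in>{1..p}. card {i \<in> tuples n. \<forall>c\<in>{a}. i c = k})"
    by (intro card_UN_le) simp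
  also have "\<dots> \<le> (\<Sum>a\<in>{1..p}. n ^ (p - 1))"
    using card_tuples_constrained[of "{_}" n "\<lambda>_. k"] by (intro sum_mono) auto
  finally show ?thesis by simp
qed

lemma card_tuples_containing_two:
  assumes "k \<noteq> l"
  shows "card {i \<in> tuples n. k \<in> i ` {1..p} \<and> l \<in> i ` {1..p}} \<le> p\<^sup>2 * n ^ (p - 2)"
proof -
  \<comment> \<open>Requiring distinct positions empties the diagonal pairs, so each of the p^2
    pairs either fixes two entries of the tuple or contributes nothing.\<close>
  let ?T = "\<lambda>(a, b). {i \<in> tuples n. a \<noteq> b \<and> i a = k \<and> i b = l}"
  have "{i \<in> tuples n. k \<in> i ` {1..p} \<and> l \<in> i ` {1..p}} \<subseteq> (\<Union>ab\<in>{1..p} \<times> {1..p}. ?T ab)"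
  proof
    fix i assume "i \<in> {i \<in> tuples n. k \<in> i ` {1..p} \<and> l \<in> i ` {1..p}}"
    then obtain a b where "i \<in> tuples n" "a \<in> {1..p}" "b \<in> {1..p}" "k = i a" "l = i b" by blast
    then show "i \<in> (\<Union>ab\<in>{1..p} \<times> {1..p}. ?T ab)"
      using assms by (intro UN_I[of "(a, b)"]) auto
  qed
  then have "card {i \<in> tuples n. k \<in> i ` {1..p} \<and> l \<in> i ` {1..p}} \<le> card (\<Union>ab\<in>{1..p} \<times> {1..p}. ?T ab)"
    by (intro card_mono) (auto simp: split_beta)
  also have "\<dots> \<le> (\<Sum>ab\<in>{1..p} \<times> {1..p}. card (?T ab))" by (intro card_UN_le) simp
  also have "\<dots> \<le> (\<Sum>ab\<in>{1..p} \<times> {1..p}. n ^ (p - 2))"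
  proof (rule sum_mono)
    fix ab assume "ab \<in> {1..p} \<times> {1..p}"
    then obtain a b where ab: "a \<in> {1..p}" "b \<in> {1..p}" "ab = (a, b)" by auto
    have "card (?T (a, b)) \<le> n ^ (p - 2)"
    proof (cases "a = b")
      case False
      then have "?T (a, b) = {i \<in> tuples n. \<forall>c\<in>{a, b}. i c = (if c = a then k else l)}" by auto
      moreover have "p - card {a, b} = p - 2" using False by simp
      ultimately show ?thesis
        using card_tuples_constrained[of "{a, b}" n "\<lambda>c. if c = a then k else l"] ab by simp
    qed simp
    then show "card (?T ab) \<le> n ^ (p - 2)" by (simp only: ab)
  qed
  finally show ?thesis by (simp add: power2_eq_square)
qed

text \<open>Only the summands whose tuple uses the index \<open>k\<close> change, each by at most
  2A.\<close>

lemma S_first_difference: "\<bar>S n (w(k := x)) - S n (w(k := y))\<bar> \<le> 2 * A * (real p * real n ^ (p - 1))"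
proof -
  let ?T = "{i \<in> tuples n. k \<in> i ` {1..p}}"
  have "S n (w(k := x)) - S n (w(k := y)) = (\<Sum>i\<in>tuples n. h i (w(k := x)) - h i (w(k := y)))"
    by (simp add: S_eq sum_subtractf)
  also have "\<dots> = (\<Sum>i\<in>?T. h i (w(k := x)) - h i (w(k := y)))"
    by (rule sum.mono_neutral_right) (auto simp: depends_upd[OF h_depends])
  finally have eq: "S n (w(k := x)) - S n (w(k := y)) = (\<Sum>i\<in>?T. h i (w(k := x)) - h i (w(k := y)))" .
  have "\<bar>S n (w(k := x)) - S n (w(k := y))\<bar> \<le> (\<Sum>i\<in>?T. 2 * A)"
    unfolding eq
  proof (intro order_trans[OF sum_abs] sum_mono)
    fix i show "\<bar>h i (w(k := x)) - h i (w(k := y))\<bar> \<le> 2 * A"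
      using h_bounds[of i "w(k := x)"] h_bounds[of i "w(k := y)"] by linarith
  qed
  also have "\<dots> = 2 * A * real (card ?T)" unfolding sum_constant by (rule mult.commute)
  also have "\<dots> \<le> 2 * A * real (p * n ^ (p - 1))"
    using A_nonneg by (intro mult_left_mono of_nat_mono card_tuples_containing) auto
  finally show ?thesis by simp
qed

text \<open>A summand whose tuple misses \<open>k\<close> or \<open>l\<close> has mixed difference
  0; each other one contributes at most 4A.\<close>

lemma S_second_difference:
  assumes "k \<noteq> l"
  shows "\<bar>(S n (w(k := x, l := u)) - S n (w(k := y, l := u))) - (S n (w(k := x, l := v)) - S n (w(k := y, l := v)))\<bar>
    \<le> 4 * A * ((real p)\<^sup>2 * real n ^ (p - 2))"
proof -
  let ?T = "{i \<in> tuples n. k \<in> i ` {1..p} \<and> l \<in> i ` {1..p}}"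
  define d where "d i = (h i (w(k := x, l := u)) - h i (w(k := y, l := u))) - (h i (w(k := x, l := v)) - h i (w(k := y, l := v)))" for i
  let ?S = "(S n (w(k := x, l := u)) - S n (w(k := y, l := u))) - (S n (w(k := x, l := v)) - S n (w(k := y, l := v)))"
  have "?S = (\<Sum>i\<in>tuples n. d i)"
    by (simp add: S_eq d_def sum_subtractf)
  also have "\<dots> = (\<Sum>i\<in>?T. d i)"
  proof (rule sum.mono_neutral_right)
    show "\<forall>i\<in>tuples n - ?T. d i = 0"
    proof
      fix i assume "i \<in> tuples n - ?T"
      then consider "l \<notin> i ` {1..p}" | "k \<notin> i ` {1..p}" by auto
      then show "d i = 0"
      proof cases
        case 1
        then show ?thesis by (simp add: d_def depends_upd[OF h_depends])
      next
        case 2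
        then show ?thesis
          using assms by (simp add: d_def fun_upd_twist[of k l] depends_upd[OF h_depends])
      qed
    qed
  qed auto
  finally have eq: "?S = (\<Sum>i\<in>?T. d i)" .
  have "\<bar>?S\<bar> \<le> (\<Sum>i\<in>?T. 4 * A)"
    unfolding eq
  proof (intro order_trans[OF sum_abs] sum_mono)
    fix i show "\<bar>d i\<bar> \<le> 4 * A"
      unfolding d_def using h_bounds[of i "w(k := x, l := u)"] h_bounds[of i "w(k := y, l := u)"]
        h_bounds[of i "w(k := x, l := v)"] h_bounds[of i "w(k := y, l := v)"] by linarith
  qed
  also have "\<dots> = 4 * A * real (card ?T)" unfolding sum_constant by (rule mult.commute)
  also have "\<dots> \<le> 4 * A * real (p\<^sup>2 * n ^ (p - 2))"
    using A_nonneg by (intro mult_left_mono of_nat_mono card_tuples_containing_two assms) auto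
  finally show ?thesis by simp
qed

text \<open>In each excluded case S_n is constant: for p = 1 there are no distances, for n = 0 the
  sum is empty, for A = 0 the kernel vanishes. That p is at least 2 gives 1/p \<le> 1/2 and makes p
  - 2 a true subtraction.\<close>

lemma variance_pos_imp:
  assumes "0 < P.variance (S n)"
  shows "p \<ge> 2" "n > 0" "A > 0"
proof -
  have const: "\<not> (\<forall>w. S n w = c)" for c
  proof
    assume "\<forall>w. S n w = c"
    then have eq: "S n = (\<lambda>_. c)" by (simp add: fun_eq_iff)
    have "P.variance (S n) = 0" unfolding eq using P.prob_space by simp
    then show False using assms by simp
  qed
  show "p \<ge> 2"
  proof (rule ccontr)
    assume "\<not> p \<ge> 2"
    then have "index_pairs p = {}" using p_pos by (auto simp: index_pairs_def)
    then have "S n w = (\<Sum>i\<in>tuples n. \<phi> (\<lambda>_. undefined))" for w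
      by (simp add: S_eq h_def restrict_def)
    then show False using const by blast
  qed
  show "n > 0"
  proof (rule ccontr)
    assume "\<not> n > 0"
    then have "tuples n = {}" using p_pos by (auto simp: tuples_def PiE_eq_empty_iff)
    then show False using const[of 0] by (simp add: S_eq)
  qed
  show "A > 0"
  proof (rule ccontr)
    assume "\<not> A > 0"
    then have "h i w = 0" for i w using h_abs_le[of i w] by simp
    then show False using const[of 0] by (simp add: S_eq)
  qed
qed

lemma
  assumes pos: "0 < P.variance (S n)"
  shows S_tail: "x \<ge> 0 \<Longrightarrow>
      P.prob {w. \<bar>S n w - integral\<^sup>L P (S n)\<bar> \<ge> 2 * A * (real p)\<^sup>2 * real n ^ (p - 1) * (x / exp 1)}
        \<le> 2 * exp ((ln (1 + x) - x) / (exp 1)\<^sup>2)"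
    and S_variance: "P.variance (S n) \<le> (2 * A * (real p)\<^sup>2 * real n ^ (p - 1))\<^sup>2"
proof -
  note vp = variance_pos_imp[OF pos]
  \<comment> \<open>With this scaling the first differences 2 A p n^(p-1) become 1/p and the mixed
    ones 4 A p^2 n^(p-2) become 2/n.\<close>
  define c where "c = 2 * A * (real p)\<^sup>2 * real n ^ (p - 1)"
  define F where "F w = S n w / c" for w
  have c: "c > 0" using vp unfolding c_def by (intro mult_pos_pos zero_less_power) auto
  have np: "real n ^ (p - 1) = real n * real n ^ (p - 2)"
  proof -
    have "p - 1 = Suc (p - 2)" using vp(1) by simp
    then show ?thesis by simp
  qed
  interpret F: degenerate_statistic \<mu> F n
  proof
    show "bmeas F" unfolding F_def[abs_def] by (intro bmeas_divide) simp
    show "depends {1..n} F" using S_depends[of n] unfolding F_def[abs_def] depends_def by metis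
    show "n > 0" by (rule vp)
  next
    fix k w x y
    have "\<bar>F (w(k := x)) - F (w(k := y))\<bar> = \<bar>S n (w(k := x)) - S n (w(k := y))\<bar> / c"
      using c by (simp add: F_def abs_divide flip: diff_divide_distrib)
    also have "\<dots> \<le> 2 * A * (real p * real n ^ (p - 1)) / c"
      using c by (intro divide_right_mono S_first_difference) auto
    also have "\<dots> = 1 / real p" using vp by (simp add: c_def power2_eq_square)
    also have "\<dots> \<le> 1 / 2" using vp(1) by (intro divide_left_mono) auto
    finally show "\<bar>F (w(k := x)) - F (w(k := y))\<bar> \<le> 1 / 2" .
  next
    fix k l :: nat and w x y u v assume "k \<noteq> l"
    have "\<bar>(F (w(k := x, l := u)) - F (w(k := y, l := u))) - (F (w(k := x, l := v)) - F (w(k := y, l := v)))\<bar>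
        = \<bar>(S n (w(k := x, l := u)) - S n (w(k := y, l := u))) - (S n (w(k := x, l := v)) - S n (w(k := y, l := v)))\<bar> / c"
      using c by (simp add: F_def abs_divide flip: diff_divide_distrib)
    also have "\<dots> \<le> 4 * A * ((real p)\<^sup>2 * real n ^ (p - 2)) / c"
      using c \<open>k \<noteq> l\<close> by (intro divide_right_mono S_second_difference) auto
    also have "\<dots> = 2 / real n"
      unfolding c_def np using vp by (simp add: field_simps power2_eq_square)
    finally show "\<bar>(F (w(k := x, l := u)) - F (w(k := y, l := u))) - (F (w(k := x, l := v)) - F (w(k := y, l := v)))\<bar>
      \<le> 2 / real n" .
  next
    fix k x show "(\<integral>w. F (w(k := x)) \<partial>P) = integral\<^sup>L P F"
      unfolding F_def[abs_def] using S_conditioned[of n k x] by simp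
  qed
  have m: "F.mean = integral\<^sup>L P (S n) / c" unfolding F_def[abs_def] by simp
  have diff: "F w - F.mean = (S n w - integral\<^sup>L P (S n)) / c" for w
    unfolding m by (simp add: F_def diff_divide_distrib)
  show "P.prob {w. \<bar>S n w - integral\<^sup>L P (S n)\<bar> \<ge> 2 * A * (real p)\<^sup>2 * real n ^ (p - 1) * (x / exp 1)}
        \<le> 2 * exp ((ln (1 + x) - x) / (exp 1)\<^sup>2)" if "x \<ge> 0"
  proof -
    have "x / exp 1 \<le> \<bar>F w - F.mean\<bar> \<longleftrightarrow> c * (x / exp 1) \<le> \<bar>S n w - integral\<^sup>L P (S n)\<bar>" for w
      using c unfolding diff by (simp add: abs_divide pos_le_divide_eq mult.commute)
    then show ?thesis using F.tail_bound[OF that] by (simp add: c_def)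
  qed
  have "(\<integral>w. (F w - F.mean)\<^sup>2 \<partial>P) = P.variance (S n) / c\<^sup>2"
    unfolding diff by (simp add: power_divide)
  then have "P.variance (S n) \<le> c\<^sup>2" using F.variance_le_1 c by (simp add: divide_le_eq)
  then show "P.variance (S n) \<le> (2 * A * (real p)\<^sup>2 * real n ^ (p - 1))\<^sup>2" unfolding c_def .
qed

end

section \<open>Convergence of the normalised variance\<close>

text \<open>The quotient is the product of the factors 1 - i/n for i < k, divided by k!; for n < k
  one factor vanishes, in agreement with the binomial coefficient.\<close>

lemma binomial_over_power_convergent: "convergent (\<lambda>n. real (n choose k) / real n ^ k)"
proof -
  have lim: "((\<lambda>n. (\<Prod>i=0..<k. 1 - real i / real n) / fact k) \<longlongrightarrow> (\<Prod>i=0..<k. 1 - 0) / fact k) sequentially"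
    by (intro tendsto_intros tendsto_divide_0[OF tendsto_const] filterlim_real_sequentially
          filterlim_at_top_imp_at_infinity) simp
  have "\<forall>\<^sub>F n in sequentially. (\<Prod>i=0..<k. 1 - real i / real n) / fact k = real (n choose k) / real n ^ k"
    using eventually_gt_at_top[of 0]
  proof eventually_elim
    case (elim n)
    have "(\<Prod>i=0..<k. 1 - real i / real n) = (\<Prod>i=0..<k. (real n - real i) / real n)"
      using elim by (intro prod.cong) (auto simp: field_simps)
    also have "\<dots> = (\<Prod>i=0..<k. real n - real i) / real n ^ k"
      by (simp add: prod_dividef)
    finally show ?case by (simp add: binomial_gbinomial gbinomial_prod_rev)
  qed
  from convergentI[OF Lim_transform_eventually[OF lim this]] show ?thesis .
qed

lemma binomial_over_higher_power_convergent:
  assumes "k \<le> m" shows "convergent (\<lambda>n. real (n choose k) / real n ^ m)"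
proof -
  have "convergent (\<lambda>n. inverse (real n) ^ (m - k))"
    by (rule convergentI[OF tendsto_power[OF lim_inverse_n]])
  then have "convergent (\<lambda>n. real (n choose k) / real n ^ k * inverse (real n) ^ (m - k))"
    by (intro convergent_mult binomial_over_power_convergent)
  moreover have "real (n choose k) / real n ^ k * inverse (real n) ^ (m - k) = real (n choose k) / real n ^ m" for n
  proof -
    have "real n ^ m = real n ^ k * real n ^ (m - k)" using assms by (simp flip: power_add)
    then show ?thesis by (simp add: divide_inverse power_inverse)
  qed
  ultimately show ?thesis by simp
qed

context iid_product
begin

text \<open>The coordinates in \<open>A\<close> are integrated out one by one. None of them is seen
  by \<open>g\<close>, and in the end \<open>f\<close> has become its mean.\<close>

lemma integral_mult_indep:
  assumes "finite A" "bmeas f" "bmeas g" "depends A f" "depends B g" "A \<inter> B = {}"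
  shows "(\<integral>w. f w * g w \<partial>P) = integral\<^sup>L P f * integral\<^sup>L P g"
  using assms
proof (induction A arbitrary: f rule: finite_induct)
  case empty
  have "f w = integral\<^sup>L P f" for w by (rule depends_empty) fact
  then have "(\<integral>w. f w * g w \<partial>P) = (\<integral>w. integral\<^sup>L P f * g w \<partial>P)" by (metis (no_types))
  then show ?case by simp
next
  case (insert k A)
  have k: "k \<notin> B" using insert.prems by auto
  have "(\<integral>w. f w * g w \<partial>P) = (\<integral>w. g w * f w \<partial>P)" by (simp only: mult.commute)
  also have "\<dots> = (\<integral>w. avg k (\<lambda>w. g w * f w) w \<partial>P)"
    by (rule integral_avg[symmetric]) (intro bmeas_intros insert.prems)
  also have "\<dots> = (\<integral>w. avg k f w * g w \<partial>P)"
    by (simp only: avg_mult_left[OF \<open>depends B g\<close> k]) (simp only: mult.commute)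
  also have "\<dots> = integral\<^sup>L P (avg k f) * integral\<^sup>L P g"
  proof (rule insert.IH)
    show "depends A (avg k f)"
      using depends_avg[OF \<open>depends (insert k A) f\<close>, of k] insert.hyps by simp
  qed (use insert.prems in auto)
  finally show ?case using insert.prems by (simp add: integral_avg)
qed

text \<open>Distinct coordinates are i.i.d., so both sides equal an integral over the product
  indexed by \<open>K\<close> alone.\<close>

lemma integral_reindex:
  assumes H: "bmeas H" "depends K H" and \<tau>: "inj_on \<tau> K"
  shows "(\<integral>w. H (\<lambda>n. w (\<tau> n)) \<partial>P) = integral\<^sup>L P H"
proof -
  let ?Q = "PiM K (\<lambda>_. \<mu>)"
  \<comment> \<open>Outside \<open>K\<close> any value would do, since \<open>H\<close> depends only
    on the coordinates in \<open>K\<close>.\<close>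
  define E where "E = (\<lambda>v n. if n \<in> K then v n else undefined :: 'a)"
  have E: "E \<in> ?Q \<rightarrow>\<^sub>M P"
    unfolding P_def
  proof (rule measurable_PiM_single')
    fix n :: nat show "(\<lambda>v. E v n) \<in> ?Q \<rightarrow>\<^sub>M \<mu>"
      by (cases "n \<in> K") (auto simp: E_def)
  qed auto
  have HE: "(\<lambda>v. H (E v)) \<in> borel_measurable ?Q"
    using measurable_compose[OF E bmeasD[OF H(1)]] .
  have *: "(\<integral>w. H (\<lambda>n. w (\<sigma> n)) \<partial>P) = (\<integral>v. H (E v) \<partial>?Q)" if \<sigma>: "inj_on \<sigma> K" for \<sigma>
  proof -
    have d: "distr P ?Q (\<lambda>w. \<lambda>n\<in>K. w (\<sigma> n)) = ?Q"
      using distr_PiM_reindex[of UNIV "\<lambda>_. \<mu>" \<sigma> K] \<sigma> prob_space_axioms by (simp add: P_def)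
    have m: "(\<lambda>w. \<lambda>n\<in>K. w (\<sigma> n)) \<in> P \<rightarrow>\<^sub>M ?Q"
      unfolding P_def by (intro measurable_restrict measurable_component_singleton) simp
    have "(\<integral>v. H (E v) \<partial>?Q) = (\<integral>v. H (E v) \<partial>distr P ?Q (\<lambda>w. \<lambda>n\<in>K. w (\<sigma> n)))"
      unfolding d ..
    also have "\<dots> = (\<integral>w. H (E (\<lambda>n\<in>K. w (\<sigma> n))) \<partial>P)" by (rule integral_distr[OF m HE])
    also have "\<dots> = (\<integral>w. H (\<lambda>n. w (\<sigma> n)) \<partial>P)"
      by (intro Bochner_Integration.integral_cong refl dependsD[OF H(2)]) (simp add: E_def)
    finally show ?thesis by simp
  qed
  have "(\<integral>w. H (\<lambda>n. w (\<tau> n)) \<partial>P) = (\<integral>w. H (\<lambda>n. w (id n)) \<partial>P)"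
    unfolding *[OF \<tau>] by (rule *[symmetric]) simp
  then show ?thesis by simp
qed

end

section \<open>Expansion of the variance in binomial coefficients\<close>

context homogeneous_statistic
begin

definition cov :: "(nat \<Rightarrow> nat) \<Rightarrow> (nat \<Rightarrow> nat) \<Rightarrow> real" where
  "cov i j = (\<integral>w. h i w * h j w \<partial>P) - integral\<^sup>L P (h i) * integral\<^sup>L P (h j)"

lemma variance_S: "P.variance (S n) = (\<Sum>(i, j)\<in>tuples n \<times> tuples n. cov i j)"
proof -
  have hh: "bmeas (\<lambda>w. h i w * h j w)" for i j by (intro bmeas_intros h_bmeas)
  have var: "P.variance (S n) = (\<integral>w. (S n w)\<^sup>2 \<partial>P) - (integral\<^sup>L P (S n))\<^sup>2"
    by (intro P.variance_eq bmeas_integrable bmeas_intros S_bmeas)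
  have "(\<integral>w. (S n w)\<^sup>2 \<partial>P) = (\<integral>w. (\<Sum>(i, j)\<in>tuples n \<times> tuples n. h i w * h j w) \<partial>P)"
    by (simp add: S_eq power2_eq_square sum_product sum.cartesian_product)
  also have "\<dots> = (\<Sum>(i, j)\<in>tuples n \<times> tuples n. (\<integral>w. h i w * h j w \<partial>P))"
    using bmeas_integrable[OF hh] by (subst Bochner_Integration.integral_sum) (auto simp: split_beta)
  finally have sq: "(\<integral>w. (S n w)\<^sup>2 \<partial>P) = (\<Sum>(i, j)\<in>tuples n \<times> tuples n. (\<integral>w. h i w * h j w \<partial>P))" .
  have "(integral\<^sup>L P (S n))\<^sup>2 = (\<Sum>(i, j)\<in>tuples n \<times> tuples n. integral\<^sup>L P (h i) * integral\<^sup>L P (h j))"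
  proof -
    have "integral\<^sup>L P (S n) = (\<Sum>i\<in>tuples n. integral\<^sup>L P (h i))"
      unfolding S_eq[abs_def] by (intro Bochner_Integration.integral_sum bmeas_integrable) simp
    then show ?thesis by (simp add: power2_eq_square sum_product sum.cartesian_product)
  qed
  then show ?thesis unfolding var sq by (simp add: cov_def split_beta sum_subtractf)
qed

text \<open>This is where homogeneity enters: conditioning on the only common coordinate makes the two
  factors independent without changing their means.\<close>

lemma cov_eq_0:
  assumes "i ` {1..p} \<inter> j ` {1..p} \<subseteq> {k}"
  shows "cov i j = 0"
proof -
  have d: "depends (i ` {1..p} - {k}) (\<lambda>w. h i (w(k := x)))" for i x
    unfolding depends_def
  proof (intro allI impI)
    fix w w' :: "nat \<Rightarrow> 'a" assume "\<forall>l\<in>i ` {1..p} - {k}. w l = w' l"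
    then show "h i (w(k := x)) = h i (w'(k := x))" by (intro dependsD[OF h_depends]) auto
  qed
  have "(\<integral>w. h i w * h j w \<partial>P) = (\<integral>x. (\<integral>w. h i (w(k := x)) * h j (w(k := x)) \<partial>P) \<partial>\<mu>)"
    by (rule integral_split) (intro bmeas_intros h_bmeas)
  also have "\<dots> = (\<integral>x. integral\<^sup>L P (h i) * integral\<^sup>L P (h j) \<partial>\<mu>)"
  proof (rule Bochner_Integration.integral_cong[OF refl])
    fix x
    have "(\<integral>w. h i (w(k := x)) * h j (w(k := x)) \<partial>P)
        = (\<integral>w. h i (w(k := x)) \<partial>P) * (\<integral>w. h j (w(k := x)) \<partial>P)"
      using assms by (intro integral_mult_indep[OF _ _ _ d d] bmeas_upd h_bmeas) auto
    then show "(\<integral>w. h i (w(k := x)) * h j (w(k := x)) \<partial>P) = integral\<^sup>L P (h i) * integral\<^sup>L P (h j)"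
      by (simp only: h_conditioned)
  qed
  finally show ?thesis by (simp add: cov_def)
qed

text \<open>Pairs of index tuples are sorted by the set of indices that they use together; their
  total covariance turns out to depend only on the size of this set.\<close>

definition pairs_onto :: "nat set \<Rightarrow> ((nat \<Rightarrow> nat) \<times> (nat \<Rightarrow> nat)) set" where
  "pairs_onto R = {(i, j). i \<in> {1..p} \<rightarrow>\<^sub>E R \<and> j \<in> {1..p} \<rightarrow>\<^sub>E R \<and> i ` {1..p} \<union> j ` {1..p} = R}"

definition cov_onto :: "nat set \<Rightarrow> real" where
  "cov_onto R = (\<Sum>(i, j)\<in>pairs_onto R. cov i j)"

lemma h_compose: "h (compose {1..p} \<tau> i) w = h i (\<lambda>n. w (\<tau> n))"
  unfolding h_def by (intro arg_cong[where f = \<phi>]) (auto simp: index_pairs_def compose_def)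

lemma h_compose_fun: "h (compose {1..p} \<tau> i) = (\<lambda>w. h i (\<lambda>n. w (\<tau> n)))"
  by (rule ext) (rule h_compose)

lemma cov_compose:
  assumes "inj_on \<tau> (i ` {1..p} \<union> j ` {1..p})"
  shows "cov (compose {1..p} \<tau> i) (compose {1..p} \<tau> j) = cov i j"
proof -
  let ?K = "i ` {1..p} \<union> j ` {1..p}"
  have di: "depends ?K (h i)" by (rule depends_mono[OF h_depends]) auto
  have dj: "depends ?K (h j)" by (rule depends_mono[OF h_depends]) auto
  have dij: "depends ?K (\<lambda>w. h i w * h j w)"
    using di dj unfolding depends_def by metis
  have "(\<integral>w. h (compose {1..p} \<tau> i) w * h (compose {1..p} \<tau> j) w \<partial>P) = (\<integral>w. h i w * h j w \<partial>P)"
    unfolding h_compose by (rule integral_reindex[OF bmeas_mult[OF h_bmeas h_bmeas] dij assms])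
  moreover have "integral\<^sup>L P (h (compose {1..p} \<tau> i)) = integral\<^sup>L P (h i)"
    unfolding h_compose_fun by (rule integral_reindex[OF h_bmeas di assms])
  moreover have "integral\<^sup>L P (h (compose {1..p} \<tau> j)) = integral\<^sup>L P (h j)"
    unfolding h_compose_fun by (rule integral_reindex[OF h_bmeas dj assms])
  ultimately show ?thesis by (simp add: cov_def)
qed

text \<open>Relabelling both tuples along \<tau> is a bijection between the two index sets of pairs,
  and it preserves covariances by \<open>cov_compose\<close>.\<close>

lemma cov_onto_card:
  assumes \<tau>: "bij_betw \<tau> K R"
  shows "cov_onto R = cov_onto K"
proof -
  have inj: "inj_on \<tau> K" and im: "\<tau> ` K = R" using \<tau> by (auto simp: bij_betw_def)
  define \<sigma> where "\<sigma> = the_inv_into K \<tau>"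
  have \<sigma>\<tau>: "\<sigma> (\<tau> x) = x" if "x \<in> K" for x using that inj by (simp add: \<sigma>_def the_inv_into_f_f)
  have \<tau>\<sigma>: "\<tau> (\<sigma> y) = y" if "y \<in> R" for y
    using that \<tau> by (simp add: \<sigma>_def f_the_inv_into_f_bij_betw)
  have bij: "bij_betw \<sigma> R K" unfolding \<sigma>_def by (rule bij_betw_the_inv_into[OF \<tau>])
  have mem: "(compose {1..p} t i, compose {1..p} t j) \<in> pairs_onto R'"
    if "(i, j) \<in> pairs_onto K'" "bij_betw t K' R'" for t i j K' R'
  proof -
    have iK: "i \<in> {1..p} \<rightarrow> K'" "j \<in> {1..p} \<rightarrow> K'" and u: "i ` {1..p} \<union> j ` {1..p} = K'"
      using that(1) by (auto simp: pairs_onto_def)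
    have im: "compose {1..p} t i ` {1..p} = t ` i ` {1..p}" for i
      by (auto simp: compose_def image_image)
    have t: "t ` K' = R'" using that(2) by (simp add: bij_betw_def)
    then have "compose {1..p} t i \<in> {1..p} \<rightarrow>\<^sub>E R'" "compose {1..p} t j \<in> {1..p} \<rightarrow>\<^sub>E R'"
      using iK by (auto simp: compose_def)
    moreover have "t ` i ` {1..p} \<union> t ` j ` {1..p} = R'" unfolding t[symmetric] u[symmetric] by blast
    ultimately show ?thesis by (simp only: pairs_onto_def mem_Collect_eq prod.case im)
  qed
  have inv: "compose {1..p} s (compose {1..p} t i) = i"
    if "i \<in> {1..p} \<rightarrow>\<^sub>E K'" "\<And>x. x \<in> K' \<Longrightarrow> s (t x) = x" for s t i K'
  proof
    fix x show "compose {1..p} s (compose {1..p} t i) x = i x"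
      using that(2)[OF PiE_mem[OF that(1), of x]] PiE_arb[OF that(1), of x] by (auto simp: compose_def)
  qed
  have invK: "compose {1..p} \<sigma> (compose {1..p} \<tau> i) = i" if "i \<in> {1..p} \<rightarrow>\<^sub>E K" for i
    using that \<sigma>\<tau> by (rule inv)
  have invR: "compose {1..p} \<tau> (compose {1..p} \<sigma> i) = i" if "i \<in> {1..p} \<rightarrow>\<^sub>E R" for i
    using that \<tau>\<sigma> by (rule inv)
  have "(\<Sum>(i, j)\<in>pairs_onto K. cov i j) = (\<Sum>(i, j)\<in>pairs_onto R. cov i j)"
  proof (rule sum.reindex_bij_witness[where
        i = "\<lambda>(i, j). (compose {1..p} \<sigma> i, compose {1..p} \<sigma> j)" and
        j = "\<lambda>(i, j). (compose {1..p} \<tau> i, compose {1..p} \<tau> j)"])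
    fix a assume "a \<in> pairs_onto K"
    then obtain i j where a: "a = (i, j)" "(i, j) \<in> pairs_onto K" by (cases a) auto
    then have *: "i \<in> {1..p} \<rightarrow>\<^sub>E K" "j \<in> {1..p} \<rightarrow>\<^sub>E K" "i ` {1..p} \<union> j ` {1..p} = K"
      by (auto simp: pairs_onto_def)
    show "(case case a of (i, j) \<Rightarrow> (compose {1..p} \<tau> i, compose {1..p} \<tau> j) of
        (i, j) \<Rightarrow> (compose {1..p} \<sigma> i, compose {1..p} \<sigma> j)) = a"
      unfolding a(1) prod.case invK[OF *(1)] invK[OF *(2)] ..
    show "(case a of (i, j) \<Rightarrow> (compose {1..p} \<tau> i, compose {1..p} \<tau> j)) \<in> pairs_onto R"
      unfolding a(1) prod.case by (rule mem[OF a(2) \<tau>])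
    show "(case case a of (i, j) \<Rightarrow> (compose {1..p} \<tau> i, compose {1..p} \<tau> j) of (i, j) \<Rightarrow> cov i j)
        = (case a of (i, j) \<Rightarrow> cov i j)"
      unfolding a(1) prod.case by (rule cov_compose) (simp only: *(3) inj)
  next
    fix a assume "a \<in> pairs_onto R"
    then obtain i j where a: "a = (i, j)" "(i, j) \<in> pairs_onto R" by (cases a) auto
    then have *: "i \<in> {1..p} \<rightarrow>\<^sub>E R" "j \<in> {1..p} \<rightarrow>\<^sub>E R" by (auto simp: pairs_onto_def)
    show "(case case a of (i, j) \<Rightarrow> (compose {1..p} \<sigma> i, compose {1..p} \<sigma> j) of
        (i, j) \<Rightarrow> (compose {1..p} \<tau> i, compose {1..p} \<tau> j)) = a"
      unfolding a(1) prod.case invR[OF *(1)] invR[OF *(2)] ..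
    show "(case a of (i, j) \<Rightarrow> (compose {1..p} \<sigma> i, compose {1..p} \<sigma> j)) \<in> pairs_onto K"
      unfolding a(1) prod.case by (rule mem[OF a(2) bij])
  qed
  then show ?thesis by (simp add: cov_onto_def)
qed

text \<open>By inclusion-exclusion, two tuples of length p that together use more than 2p - 2
  indices share at most one, and \<open>cov_eq_0\<close> applies.\<close>

lemma cov_onto_eq_0:
  assumes fin: "finite R" and card: "card R > 2 * (p - 1)"
  shows "cov_onto R = 0"
proof -
  have single: "\<exists>k. X \<subseteq> {k}" if "finite X" "card X \<le> Suc 0" for X :: "nat set"
  proof (cases "X = {}")
    case False
    then obtain k where "k \<in> X" by blast
    then have "X \<subseteq> {k}" using that card_le_Suc0_iff_eq[OF that(1)] by blast
    then show ?thesis by blast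
  qed simp
  have "cov i j = 0" if "(i, j) \<in> pairs_onto R" for i j
  proof -
    from that have R: "i ` {1..p} \<union> j ` {1..p} = R" by (simp add: pairs_onto_def)
    have "card (i ` {1..p} \<union> j ` {1..p}) + card (i ` {1..p} \<inter> j ` {1..p}) = card (i ` {1..p}) + card (j ` {1..p})"
      by (rule card_Un_Int[symmetric]) auto
    also have "\<dots> \<le> p + p" using card_image_le[of "{1..p}" i] card_image_le[of "{1..p}" j] by simp
    finally have "card (i ` {1..p} \<inter> j ` {1..p}) \<le> Suc 0" using card p_pos unfolding R by linarith
    then obtain k where "i ` {1..p} \<inter> j ` {1..p} \<subseteq> {k}"
      using single[OF finite_Int[OF disjI1[OF finite_imageI[OF finite_atLeastAtMost]]]] by metis
    then show "cov i j = 0" by (rule cov_eq_0)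
  qed
  then show ?thesis unfolding cov_onto_def by (intro sum.neutral) auto
qed

text \<open>The range of k carries the content: homogeneity removes the sizes 2p - 1 and 2p, which
  makes n^(2(p-1)) an upper bound for the order of the variance.\<close>

lemma variance_S_binomial:
  "P.variance (S n) = (\<Sum>k\<le>2 * (p - 1). real (n choose k) * cov_onto {1..k})"
proof -
  let ?m = "2 * (p - 1)"
  have fin: "finite (pairs_onto R)" if "finite R" for R
  proof (rule finite_subset)
    show "pairs_onto R \<subseteq> ({1..p} \<rightarrow>\<^sub>E R) \<times> ({1..p} \<rightarrow>\<^sub>E R)" by (auto simp: pairs_onto_def)
    show "finite (({1..p} \<rightarrow>\<^sub>E R) \<times> ({1..p} \<rightarrow>\<^sub>E R))" using that by (intro finite_cartesian_product finite_PiE) auto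
  qed
  have card: "cov_onto R = cov_onto {1..card R}" if fin: "finite R" for R
  proof -
    obtain \<tau> where "bij_betw \<tau> {1..card R} R"
      using finite_same_card_bij[of "{1..card R}" R] fin by auto
    then show ?thesis by (rule cov_onto_card)
  qed
  have img: "(\<lambda>(i, j). i ` {1..p} \<union> j ` {1..p}) ` (tuples n \<times> tuples n) \<subseteq> Pow {1..n}"
  proof (rule image_subsetI)
    fix ij assume "ij \<in> tuples n \<times> tuples n"
    then show "(\<lambda>(i, j). i ` {1..p} \<union> j ` {1..p}) ij \<in> Pow {1..n}"
      using tuples_range[of "fst ij" n] tuples_range[of "snd ij" n] by (simp add: split_beta mem_Times_iff)
  qed
  have "P.variance (S n) = (\<Sum>R\<in>Pow {1..n}.
      \<Sum>(i, j)\<in>{ij \<in> tuples n \<times> tuples n. (\<lambda>(i, j). i ` {1..p} \<union> j ` {1..p}) ij = R}. cov i j)"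
    unfolding variance_S using img by (intro sum.group[symmetric]) auto
  also have "\<dots> = (\<Sum>R\<in>Pow {1..n}. cov_onto R)"
    unfolding cov_onto_def
  proof (intro sum.cong refl)
    fix R assume R: "R \<in> Pow {1..n}"
    show "{ij \<in> tuples n \<times> tuples n. (\<lambda>(i, j). i ` {1..p} \<union> j ` {1..p}) ij = R} = pairs_onto R"
    proof (intro Set.set_eqI iffI)
      fix ij assume "ij \<in> {ij \<in> tuples n \<times> tuples n. (\<lambda>(i, j). i ` {1..p} \<union> j ` {1..p}) ij = R}"
      then show "ij \<in> pairs_onto R" by (auto simp: tuples_def pairs_onto_def PiE_def)
    next
      fix ij assume "ij \<in> pairs_onto R"
      moreover have "{1..p} \<rightarrow>\<^sub>E R \<subseteq> {1..p} \<rightarrow>\<^sub>E {1..n}" using R by (intro PiE_mono) auto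
      ultimately show "ij \<in> {ij \<in> tuples n \<times> tuples n. (\<lambda>(i, j). i ` {1..p} \<union> j ` {1..p}) ij = R}"
        unfolding tuples_def pairs_onto_def by auto
    qed
  qed
  also have "\<dots> = (\<Sum>R\<in>{R \<in> Pow {1..n}. card R \<le> ?m}. cov_onto R)"
    by (rule sum.mono_neutral_right)
      (auto intro!: cov_onto_eq_0 intro: finite_subset simp: not_le)
  also have "\<dots> = (\<Sum>k\<le>?m. \<Sum>R\<in>{R \<in> {R \<in> Pow {1..n}. card R \<le> ?m}. card R = k}. cov_onto R)"
    by (rule sum.group[symmetric]) auto
  also have "\<dots> = (\<Sum>k\<le>?m. real (n choose k) * cov_onto {1..k})"
  proof (rule sum.cong[OF refl])
    fix k assume k: "k \<in> {..?m}"
    have "(\<Sum>R\<in>{R \<in> {R \<in> Pow {1..n}. card R \<le> ?m}. card R = k}. cov_onto R)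
        = (\<Sum>R\<in>{R. R \<subseteq> {1..n} \<and> card R = k}. cov_onto {1..k})"
    proof (rule sum.cong)
      fix R assume "R \<in> {R. R \<subseteq> {1..n} \<and> card R = k}"
      then show "cov_onto R = cov_onto {1..k}" using card[of R] finite_subset[of R "{1..n}"] by auto
    qed (use k in auto)
    also have "\<dots> = real (n choose k) * cov_onto {1..k}" by (simp add: n_subsets)
    finally show "(\<Sum>R\<in>{R \<in> {R \<in> Pow {1..n}. card R \<le> ?m}. card R = k}. cov_onto R)
        = real (n choose k) * cov_onto {1..k}" .
  qed
  finally show ?thesis .
qed

text \<open>\<open>sigma2_hom\<close> is defined through \<open>lim\<close>, which is meaningful
  only once convergence is known.\<close>

lemma convergent_normalized_variance: "convergent (\<lambda>n. P.variance (S n) / real n ^ (2 * (p - 1)))"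
proof -
  have "P.variance (S n) / real n ^ (2 * (p - 1))
      = (\<Sum>k\<le>2 * (p - 1). real (n choose k) / real n ^ (2 * (p - 1)) * cov_onto {1..k})" for n
    unfolding variance_S_binomial by (simp add: sum_divide_distrib)
  then show ?thesis
    by (simp only:) (intro convergent_sum convergent_mult convergent_const binomial_over_higher_power_convergent, simp)
qed

end

section \<open>Independent samples and the limit law\<close>

text \<open>Weak convergence controls the limit law from above on open sets only, so a closed event
  for the limit is compared with a slightly larger event for the sequence: a level u with s < u < t
  at which the distribution functions converge.\<close>

lemma prob_abs_ge_le_of_weak_conv:
  fixes Y :: "'v \<Rightarrow> real" and Y' :: "nat \<Rightarrow> 'w \<Rightarrow> real" and r B :: "real \<Rightarrow> real"
  assumes N: "prob_space N" and Y: "Y \<in> borel_measurable N"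
    and M: "prob_space M" and Y': "\<And>n. Y' n \<in> borel_measurable M"
    and conv: "weak_conv_m (\<lambda>n. distr M borel (Y' n)) (distr N borel Y)"
    and bound: "\<forall>\<^sub>F n in sequentially. measure M {w \<in> space M. \<bar>Y' n w\<bar> \<ge> s} \<le> b"
    and st: "s < t"
  shows "measure N {w \<in> space N. \<bar>Y w\<bar> \<ge> t} \<le> b"
proof -
  interpret N: prob_space N by fact
  interpret M: prob_space M by fact
  interpret L: real_distribution "distr N borel Y" by (rule N.real_distribution_distr) (rule Y)
  let ?L = "distr N borel Y"
  define D where "D = {x. measure ?L {x} \<noteq> 0}"
  \<comment> \<open>The limit law has countably many atoms, so some u in the gap makes both u and -u
    continuity points.\<close>
  have "countable (D \<union> uminus ` D)" unfolding D_def using L.countable_support by auto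
  moreover have "uncountable {max 0 s<..<t}" if "t > 0" using st that by (simp add: uncountable_open_interval)
  ultimately have ex: "\<exists>u. u \<in> {max 0 s<..<t} \<and> u \<notin> D \<and> - u \<notin> D" if "t > 0"
    using that by (metis (no_types, lifting) UnI1 UnI2 countable_subset image_eqI minus_minus subsetI)
  show ?thesis
  proof (cases "t > 0")
    case True
    then obtain u where u: "0 < u" "s < u" "u < t" "u \<notin> D" "- u \<notin> D" using ex by auto
    have cdf_diff: "1 - (cdf (distr K borel Z) u - cdf (distr K borel Z) (- u))
        = measure K {w \<in> space K. \<not> (- u < Z w \<and> Z w \<le> u)}"
      if K: "prob_space K" and Z: "Z \<in> borel_measurable K" for K and Z :: "'c \<Rightarrow> real"
    proof -
      interpret K: prob_space K by fact
      interpret LK: real_distribution "distr K borel Z" by (rule K.real_distribution_distr) (rule Z)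
      have "cdf (distr K borel Z) u - cdf (distr K borel Z) (- u) = measure (distr K borel Z) {- u<..u}"
        using u by (intro LK.cdf_diff_eq) simp
      also have "\<dots> = measure K (Z -` {- u<..u} \<inter> space K)" using Z by (intro measure_distr) auto
      also have "\<dots> = measure K {w \<in> space K. - u < Z w \<and> Z w \<le> u}"
        by (rule arg_cong[where f = "measure K"]) auto
      finally show ?thesis using K.prob_neg[of "\<lambda>w. - u < Z w \<and> Z w \<le> u"] Z by simp
    qed
    have lim: "(\<lambda>n. cdf (distr M borel (Y' n)) v) \<longlonglongrightarrow> cdf ?L v" if "v \<notin> D" for v
      using conv that L.isCont_cdf unfolding weak_conv_m_def weak_conv_def D_def by blast
    have "(\<lambda>n. 1 - (cdf (distr M borel (Y' n)) u - cdf (distr M borel (Y' n)) (- u)))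
        \<longlonglongrightarrow> 1 - (cdf ?L u - cdf ?L (- u))"
      by (intro tendsto_intros lim u)
    then have *: "(\<lambda>n. measure M {w \<in> space M. \<not> (- u < Y' n w \<and> Y' n w \<le> u)})
        \<longlonglongrightarrow> measure N {w \<in> space N. \<not> (- u < Y w \<and> Y w \<le> u)}"
      by (simp only: cdf_diff[OF M Y'] cdf_diff[OF N Y])
    have "\<forall>\<^sub>F n in sequentially. measure M {w \<in> space M. \<not> (- u < Y' n w \<and> Y' n w \<le> u)} \<le> b"
      using bound
    proof eventually_elim
      case (elim n)
      note Y'[of n, measurable]
      have "measure M {w \<in> space M. \<not> (- u < Y' n w \<and> Y' n w \<le> u)} \<le> measure M {w \<in> space M. \<bar>Y' n w\<bar> \<ge> s}"
        using u by (intro M.finite_measure_mono) auto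
      then show ?case using elim by linarith
    qed
    then have "measure N {w \<in> space N. \<not> (- u < Y w \<and> Y w \<le> u)} \<le> b"
      by (rule tendsto_upperbound[OF *]) simp
    moreover have "measure N {w \<in> space N. \<bar>Y w\<bar> \<ge> t} \<le> measure N {w \<in> space N. \<not> (- u < Y w \<and> Y w \<le> u)}"
    proof -
      note Y[measurable]
      show ?thesis using u by (intro N.finite_measure_mono) auto
    qed
    ultimately show ?thesis by linarith
  next
    case False
    \<comment> \<open>For a nonpositive level the event is the whole space, which forces b to be at
      least 1.\<close>
    then have s: "s \<le> 0" using st by simp
    obtain n where "measure M {w \<in> space M. \<bar>Y' n w\<bar> \<ge> s} \<le> b"
      using eventually_happens'[OF sequentially_bot bound] by blast
    moreover have "{w \<in> space M. \<bar>Y' n w\<bar> \<ge> s} = space M" using s by auto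
    ultimately have "1 \<le> b" using M.prob_space by simp
    then show ?thesis by (rule order_trans[OF N.prob_le_1])
  qed
qed

section \<open>Transfer to a given i.i.d. sample and passage to the limit\<close>

context homogeneous_statistic
begin

context
  fixes M :: "'w measure" and X :: "nat \<Rightarrow> 'w \<Rightarrow> 'a"
  assumes iid: "iid_sequence M X \<mu>"
begin

interpretation M: prob_space M
  using iid by (simp add: iid_sequence_def)

lemma S_stat_coord: "S_stat p \<phi> X n \<omega> = S n (\<lambda>i. X i \<omega>)"
  by (simp add: S_stat_def)

lemma
  shows measurable_S_stat: "S_stat p \<phi> X n \<in> borel_measurable M"
    and distr_S_stat: "distr M borel (S_stat p \<phi> X n) = distr P borel (S n)"
proof -
  \<comment> \<open>Nothing is known about \<open>X 0\<close>, not even measurability, so the sample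
    and the coordinates of \<open>P\<close> are compared on the indices from 1 on, where both have
    the law \<open>?Q\<close>.\<close>
  let ?K = "{1..} :: nat set"
  let ?Q = "PiM ?K (\<lambda>_. \<mu>)"
  let ?X = "\<lambda>\<omega>. \<lambda>i\<in>?K. X i \<omega>"
  have rv: "X i \<in> M \<rightarrow>\<^sub>M borel" if "i \<in> ?K" for i
    using iid that unfolding iid_sequence_def M.indep_vars_def by auto
  have setsQ: "sets (PiM ?K (\<lambda>_. borel)) = sets ?Q" by (intro sets_PiM_cong) (simp_all add: sets_mu)
  have "distr M (PiM ?K (\<lambda>_. borel)) ?X = PiM ?K (\<lambda>i. distr M borel (X i))"
    using iid rv by (subst M.indep_vars_iff_distr_eq_PiM'[symmetric]) (auto simp: iid_sequence_def)
  also have "\<dots> = ?Q" using iid by (intro PiM_cong) (auto simp: iid_sequence_def)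
  finally have law: "distr M ?Q ?X = ?Q" using setsQ by (simp cong: distr_cong)
  have mX: "?X \<in> M \<rightarrow>\<^sub>M ?Q"
    by (subst measurable_cong_sets[OF refl setsQ[symmetric]]) (intro measurable_restrict rv)
  \<comment> \<open>Coordinate 0 receives an arbitrary value; \<open>S n\<close> reads only the
    coordinates 1, ..., n.\<close>
  define E where "E = (\<lambda>v n. if n \<in> ?K then v n else undefined :: 'a)"
  have E: "E \<in> ?Q \<rightarrow>\<^sub>M P"
    unfolding P_def
  proof (rule measurable_PiM_single')
    fix n :: nat show "(\<lambda>v. E v n) \<in> ?Q \<rightarrow>\<^sub>M \<mu>"
      by (cases "n \<in> ?K") (auto simp: E_def)
  qed auto
  have SE: "(\<lambda>v. S n (E v)) \<in> borel_measurable ?Q"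
    using measurable_compose[OF E bmeasD[OF S_bmeas]] .
  have eqX: "S_stat p \<phi> X n = (\<lambda>v. S n (E v)) \<circ> ?X"
    by (auto simp: fun_eq_iff S_stat_coord E_def intro!: dependsD[OF S_depends])
  show "S_stat p \<phi> X n \<in> borel_measurable M"
    unfolding eqX using mX SE by (rule measurable_comp)
  have mR: "(\<lambda>w. \<lambda>i\<in>?K. w i) \<in> P \<rightarrow>\<^sub>M ?Q"
    unfolding P_def by (intro measurable_restrict measurable_component_singleton) simp
  have lawR: "distr P ?Q (\<lambda>w. \<lambda>i\<in>?K. w i) = ?Q"
    using distr_PiM_reindex[of UNIV "\<lambda>_. \<mu>" id ?K] prob_space_axioms by (simp add: P_def)
  have eqR: "S n = (\<lambda>v. S n (E v)) \<circ> (\<lambda>w. \<lambda>i\<in>?K. w i)"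
    by (auto simp: fun_eq_iff E_def intro!: dependsD[OF S_depends])
  have "distr M borel (S_stat p \<phi> X n) = distr (distr M ?Q ?X) borel (\<lambda>v. S n (E v))"
    unfolding eqX by (rule distr_distr[symmetric]) (fact SE mX)+
  also have "\<dots> = distr (distr P ?Q (\<lambda>w. \<lambda>i\<in>?K. w i)) borel (\<lambda>v. S n (E v))"
    unfolding law lawR ..
  also have "\<dots> = distr P borel ((\<lambda>v. S n (E v)) \<circ> (\<lambda>w. \<lambda>i\<in>?K. w i))"
    by (rule distr_distr) (fact SE mR)+
  also have "\<dots> = distr P borel (S n)" unfolding eqR[symmetric] ..
  finally show "distr M borel (S_stat p \<phi> X n) = distr P borel (S n)" .
qed

lemma integral_S_stat:
  fixes f :: "real \<Rightarrow> real"
  assumes f: "f \<in> borel_measurable borel"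
  shows "(\<integral>\<omega>. f (S_stat p \<phi> X n \<omega>) \<partial>M) = (\<integral>w. f (S n w) \<partial>P)"
  using integral_distr[OF measurable_S_stat f, of n] integral_distr[OF bmeasD[OF S_bmeas] f, of n]
  by (simp add: distr_S_stat)

lemma expectation_S_stat: "M.expectation (S_stat p \<phi> X n) = integral\<^sup>L P (S n)"
  using integral_S_stat[of "\<lambda>x. x" n] by simp

lemma variance_S_stat: "M.variance (S_stat p \<phi> X n) = P.variance (S n)"
  unfolding expectation_S_stat
  using integral_S_stat[of "\<lambda>x. (x - integral\<^sup>L P (S n))\<^sup>2" n] by simp

lemma prob_S_stat:
  assumes "B \<in> sets borel"
  shows "\<P>(\<omega> in M. S_stat p \<phi> X n \<omega> \<in> B) = P.prob {w. S n w \<in> B}"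
proof -
  have "\<P>(\<omega> in M. S_stat p \<phi> X n \<omega> \<in> B) = measure (distr M borel (S_stat p \<phi> X n)) B"
    using assms by (subst measure_distr[OF measurable_S_stat])
      (auto intro!: arg_cong[where f = "measure M"])
  also have "\<dots> = P.prob {w. S n w \<in> B}"
    unfolding distr_S_stat using assms by (subst measure_distr[OF bmeasD[OF S_bmeas]])
      (auto intro!: arg_cong[where f = P.prob])
  finally show ?thesis .
qed

lemma expectation_Phi_stat: "M.expectation (Phi_stat p \<phi> X n) = integral\<^sup>L P (S n) / real n ^ p"
  unfolding Phi_stat_def[abs_def] using expectation_S_stat by simp

lemma variance_Phi_stat: "M.variance (Phi_stat p \<phi> X n) = P.variance (S n) / (real n ^ p)\<^sup>2"
proof -
  have "M.variance (Phi_stat p \<phi> X n) = (\<integral>\<omega>. (S_stat p \<phi> X n \<omega> - integral\<^sup>L P (S n))\<^sup>2 / (real n ^ p)\<^sup>2 \<partial>M)"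
    unfolding expectation_Phi_stat by (simp add: Phi_stat_def power_divide flip: diff_divide_distrib)
  then show ?thesis using variance_S_stat unfolding expectation_S_stat by simp
qed

lemma variance_S_pos:
  assumes "M.variance (Phi_stat p \<phi> X n) > 0"
  shows "P.variance (S n) > 0"
proof (rule ccontr)
  assume "\<not> ?thesis"
  then have "P.variance (S n) / (real n ^ p)\<^sup>2 \<le> 0" by (intro divide_nonpos_nonneg) auto
  then show False using assms unfolding variance_Phi_stat by linarith
qed

lemma Y_stat_eq:
  assumes "n > 0"
  shows "Y_stat M p \<phi> X n \<omega> = (S_stat p \<phi> X n \<omega> - integral\<^sup>L P (S n)) / sqrt (P.variance (S n))"
proof -
  have "real n ^ p > 0" using assms by simp
  then show ?thesis
    unfolding Y_stat_def variance_Phi_stat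
    unfolding expectation_Phi_stat Phi_stat_def by (simp add: real_sqrt_divide flip: diff_divide_distrib)
qed

lemma sigma2_n_hom_eq: "sigma2_n_hom M p \<phi> X n = P.variance (S n) / real n ^ (2 * (p - 1))"
  by (simp add: sigma2_n_hom_def variance_S_stat)

lemma sqrt_sigma2_n_hom: "sqrt (sigma2_n_hom M p \<phi> X n) = sqrt (P.variance (S n)) / real n ^ (p - 1)"
proof -
  have "sqrt (real n ^ (2 * (p - 1))) = real n ^ (p - 1)"
    by (simp add: real_sqrt_unique flip: power_mult add: mult.commute)
  then show ?thesis by (simp add: sigma2_n_hom_eq real_sqrt_divide)
qed

lemma sigma2_n_hom_tendsto: "sigma2_n_hom M p \<phi> X \<longlonglongrightarrow> sigma2_hom M p \<phi> X"
  using convergent_normalized_variance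
  unfolding sigma2_hom_def sigma2_n_hom_eq[abs_def] by (simp add: convergent_LIMSEQ_iff)

abbreviation ratio :: "nat \<Rightarrow> real" where
  "ratio n \<equiv> 2 * A * (real p)\<^sup>2 / sqrt (sigma2_n_hom M p \<phi> X n)"

lemma ratio_eq: "ratio n = 2 * A * (real p)\<^sup>2 * real n ^ (p - 1) / sqrt (P.variance (S n))"
  by (simp add: sqrt_sigma2_n_hom)

lemma ratio_ge_1:
  assumes "M.variance (Phi_stat p \<phi> X n) > 0"
  shows "1 \<le> ratio n"
proof -
  have pos: "P.variance (S n) > 0" by (rule variance_S_pos) fact
  have "sqrt (P.variance (S n)) \<le> 2 * A * (real p)\<^sup>2 * real n ^ (p - 1)"
    using A_nonneg by (intro real_le_lsqrt S_variance pos) auto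
  then show ?thesis unfolding ratio_eq using pos by simp
qed

lemma Y_stat_tail:
  assumes "M.variance (Phi_stat p \<phi> X n) > 0" and x: "x \<ge> 0"
  shows "\<P>(\<omega> in M. \<bar>Y_stat M p \<phi> X n \<omega>\<bar> \<ge> ratio n * x / exp 1) \<le> 2 * exp ((ln (1 + x) - x) / (exp 1)\<^sup>2)"
proof -
  have pos: "P.variance (S n) > 0" by (rule variance_S_pos) fact
  note n = variance_pos_imp(2)[OF pos]
  define c where "c = 2 * A * (real p)\<^sup>2 * real n ^ (p - 1)"
  define B where "B = {s. \<bar>s - integral\<^sup>L P (S n)\<bar> \<ge> c * (x / exp 1)}"
  have B: "B \<in> sets borel" unfolding B_def by measurable
  have "ratio n * x / exp 1 \<le> \<bar>Y_stat M p \<phi> X n \<omega>\<bar> \<longleftrightarrow> S_stat p \<phi> X n \<omega> \<in> B" for \<omega>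
  proof -
    have "ratio n * x / exp 1 = c * (x / exp 1) / sqrt (P.variance (S n))"
      by (simp add: ratio_eq c_def)
    moreover have "\<bar>Y_stat M p \<phi> X n \<omega>\<bar> = \<bar>S_stat p \<phi> X n \<omega> - integral\<^sup>L P (S n)\<bar> / sqrt (P.variance (S n))"
      using pos by (simp add: Y_stat_eq[OF n] abs_divide)
    moreover have "sqrt (P.variance (S n)) > 0" using pos by simp
    ultimately show ?thesis by (simp only: B_def mem_Collect_eq divide_le_cancel) auto
  qed
  then have "\<P>(\<omega> in M. \<bar>Y_stat M p \<phi> X n \<omega>\<bar> \<ge> ratio n * x / exp 1) = P.prob {w. S n w \<in> B}"
    using prob_S_stat[OF B, of n] by simp
  also have "\<dots> \<le> 2 * exp ((ln (1 + x) - x) / (exp 1)\<^sup>2)"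
    using S_tail[OF pos x] by (simp add: B_def c_def)
  finally show ?thesis .
qed

lemma measurable_Y_stat: "Y_stat M p \<phi> X n \<in> borel_measurable M"
  unfolding Y_stat_def[abs_def] Phi_stat_def using measurable_S_stat by measurable

context
  assumes sigma_pos: "sigma2_hom M p \<phi> X > 0"
begin

abbreviation limit_ratio :: real where
  "limit_ratio \<equiv> 2 * A * (real p)\<^sup>2 / sqrt (sigma2_hom M p \<phi> X)"

lemma ratio_tendsto: "ratio \<longlonglongrightarrow> limit_ratio"
  using sigma_pos
  by (intro tendsto_intros sigma2_n_hom_tendsto) auto

lemma eventually_variance_pos: "\<forall>\<^sub>F n in sequentially. M.variance (Phi_stat p \<phi> X n) > 0"
  using order_tendstoD(1)[OF sigma2_n_hom_tendsto sigma_pos] eventually_gt_at_top[of 0]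
proof eventually_elim
  case (elim n)
  then have "P.variance (S n) > 0"
    by (simp add: sigma2_n_hom_eq zero_less_divide_iff)
  then show ?case using elim unfolding variance_Phi_stat by simp
qed

text \<open>The thresholds for finite n move with \<open>ratio n\<close>, and weak convergence needs
  a gap. So the tail bound at y < x is transferred to the event for x, and then y tends to x from
  the left, where the right-hand side is continuous.\<close>

lemma limit_tail:
  assumes N: "prob_space N" and Y: "Y \<in> borel_measurable N"
    and conv: "weak_conv_m (\<lambda>n. distr M borel (Y_stat M p \<phi> X n)) (distr N borel Y)"
    and x: "x \<ge> 0"
  shows "\<P>(\<omega> in N. \<bar>Y \<omega>\<bar> \<ge> limit_ratio * x / exp 1) \<le> 2 * exp ((ln (1 + x) - x) / (exp 1)\<^sup>2)"
proof (cases "x = 0")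
  case True
  interpret N: prob_space N by fact
  \<comment> \<open>At x = 0 the bound is 2; the approach from the left needs x > 0.\<close>
  show ?thesis by (rule order_trans[OF N.prob_le_1]) (simp add: True)
next
  case False
  then have x: "x > 0" using x by simp
  \<comment> \<open>Used only for positivity: it makes the gap between the thresholds for y and x
    strict, which leaves room for \<open>s\<close>.\<close>
  have "1 \<le> limit_ratio"
    using ratio_tendsto by (rule tendsto_lowerbound)
      (use eventually_variance_pos in \<open>auto elim!: eventually_mono intro: ratio_ge_1\<close>)
  have bound: "\<P>(\<omega> in N. \<bar>Y \<omega>\<bar> \<ge> limit_ratio * x / exp 1) \<le> 2 * exp ((ln (1 + y) - y) / (exp 1)\<^sup>2)"
    if y: "0 \<le> y" "y < x" for y
  proof -
    have "limit_ratio * y / exp 1 < limit_ratio * x / exp 1"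
      using y \<open>1 \<le> limit_ratio\<close> by (intro divide_strict_right_mono mult_strict_left_mono) auto
    then obtain s where s: "limit_ratio * y / exp 1 < s" "s < limit_ratio * x / exp 1"
      using dense by blast
    have "(\<lambda>n. ratio n * y / exp 1) \<longlonglongrightarrow> limit_ratio * y / exp 1"
      by (intro tendsto_intros ratio_tendsto) simp
    from order_tendstoD(2)[OF this s(1)] eventually_variance_pos
    have "\<forall>\<^sub>F n in sequentially. \<P>(\<omega> in M. \<bar>Y_stat M p \<phi> X n \<omega>\<bar> \<ge> s) \<le> 2 * exp ((ln (1 + y) - y) / (exp 1)\<^sup>2)"
    proof eventually_elim
      case (elim n)
      note measurable_Y_stat[measurable]
      have "\<P>(\<omega> in M. \<bar>Y_stat M p \<phi> X n \<omega>\<bar> \<ge> s) \<le> \<P>(\<omega> in M. \<bar>Y_stat M p \<phi> X n \<omega>\<bar> \<ge> ratio n * y / exp 1)"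
        using elim(1) by (intro M.finite_measure_mono) auto
      also have "\<dots> \<le> 2 * exp ((ln (1 + y) - y) / (exp 1)\<^sup>2)" using elim(2) y by (intro Y_stat_tail)
      finally show ?case .
    qed
    then show ?thesis
      using prob_abs_ge_le_of_weak_conv[OF N Y M.prob_space_axioms measurable_Y_stat conv _ s(2)] by simp
  qed
  have "((\<lambda>y. 2 * exp ((ln (1 + y) - y) / (exp 1)\<^sup>2)) \<longlongrightarrow> 2 * exp ((ln (1 + x) - x) / (exp 1)\<^sup>2)) (at_left x)"
    using x by (intro tendsto_intros) auto
  moreover have "\<forall>\<^sub>F y in at_left x. \<P>(\<omega> in N. \<bar>Y \<omega>\<bar> \<ge> limit_ratio * x / exp 1) \<le> 2 * exp ((ln (1 + y) - y) / (exp 1)\<^sup>2)"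
    using eventually_at_left[OF x] bound x by (auto intro!: exI[of _ 0])
  ultimately show ?thesis by (rule tendsto_lowerbound) simp
qed

end

end

end

lemma homogeneous_statistic_of_compact_homogeneous:
  assumes hom: "compact_homogeneous_space G T \<mu>" and "p \<ge> 1" "bounded_continuous p \<phi>"
  shows "homogeneous_statistic \<mu> p \<phi>"
proof -
  have mm: "prob_space \<mu>" "sets \<mu> = sets borel"
    using hom by (auto simp: compact_homogeneous_space_def mm_space_def)
  interpret prob_space \<mu> by (rule mm)
  have "space \<mu> = UNIV" using sets_eq_imp_space_eq[OF mm(2)] by simp
  then show ?thesis
    using mm(2) assms compact_homogeneous_transitive[OF hom] by unfold_locales auto
qed

theorem proposition5p8:
  fixes G :: "('g, 'z) monoid_scheme" and T :: "'g topology"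
    and \<mu> :: "'a::polish_space measure"
    and M :: "'w measure" and X :: "nat \<Rightarrow> 'w \<Rightarrow> 'a"
    and p :: nat and \<phi> :: "(nat \<times> nat \<Rightarrow> real) \<Rightarrow> real"
    and A q :: real and q_n :: "nat \<Rightarrow> real"
  assumes "compact_homogeneous_space G T \<mu>"
    and "iid_sequence M X \<mu>"
    and "p \<ge> 1"
    and "bounded_continuous p \<phi>"
    and "A = sup_norm p \<phi>"
    and "sigma2_hom M p \<phi> X > 0"
    and "\<And>n. q_n n = 2 * A * (real p)\<^sup>2 / sqrt (sigma2_n_hom M p \<phi> X n)"
    and "q = 2 * A * (real p)\<^sup>2 / sqrt (sigma2_hom M p \<phi> X)"
  shows "(\<forall>n. prob_space.variance M (Phi_stat p \<phi> X n) > 0 \<longrightarrow>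
            q_n n \<ge> 1 \<and>
            (\<forall>x\<ge>0. \<P>(\<omega> in M. \<bar>Y_stat M p \<phi> X n \<omega>\<bar> \<ge> q_n n * x / exp 1)
                      \<le> 2 * exp ((ln (1 + x) - x) / (exp 1)\<^sup>2))) \<and>
         q_n \<longlonglongrightarrow> q \<and>
         (\<forall>(N :: 'v measure) Y. prob_space N \<and> Y \<in> borel_measurable N \<and>
            weak_conv_m (\<lambda>n. distr M borel (Y_stat M p \<phi> X n)) (distr N borel Y) \<longrightarrow>
            (\<forall>x\<ge>0. \<P>(\<omega> in N. \<bar>Y \<omega>\<bar> \<ge> q * x / exp 1)
                      \<le> 2 * exp ((ln (1 + x) - x) / (exp 1)\<^sup>2)))"
proof -
  interpret homogeneous_statistic \<mu> p \<phi>
    using assms(1,3,4) by (rule homogeneous_statistic_of_compact_homogeneous)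
  note iid = assms(2) and sigma_pos = assms(6)
  have q_n: "q_n = (\<lambda>n. 2 * sup_norm p \<phi> * (real p)\<^sup>2 / sqrt (sigma2_n_hom M p \<phi> X n))"
    using assms(5,7) by (simp add: fun_eq_iff)
  have q: "q = 2 * sup_norm p \<phi> * (real p)\<^sup>2 / sqrt (sigma2_hom M p \<phi> X)"
    using assms(5,8) by simp
  show ?thesis
    unfolding q_n q
    using ratio_ge_1[OF iid] Y_stat_tail[OF iid] ratio_tendsto[OF iid sigma_pos] limit_tail[OF iid sigma_pos]
    by blast
qed

end
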